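(* Let $K$ be a compact metric space and $\mu$ a finite Borel measure on $K$. Let $S=(S_t)_{t>0}$ be a semigroup on $L_2(K,\mu)$ (no continuity in $t$ is assumed). Then the following are equivalent. (i) The operator $S_t$ has a continuous kernel for all $t>0$. (ii) There exists a $p_0\in[2,\infty)$ such that $S_t L_{p_0}(K)\subset C(K)$ and $S_t^* L_{p_0}(K)\subset C(K)$ for all $t>0$. (iii) $S_t L_2(K)\subset C(K)$ and $S_t^* L_2(K)\subset C(K)$ for all $t>0$.
   Context: A semigroup on a Banach space $X$ is a map $S\colon(0,\infty)\to\mathcal{L}(X)$ (bounded operators) with $S_{t+s}=S_tS_s$ for all $t,s>0$, without any further continuity assumption. $S_t$ has a continuous kernel if there is a continuous function $k_t\colon K\times K\to\mathbb{C}$ such that for all $u\in L_2(K,\mu)$ one has $(S_tu)(x)=\int_K k_t(x,y)\,u(y)\,d\mu(y)$ for almost every $x\in K$. $S_t^*$ is the Hilbert space adjoint. $L_p(K)=L_p(K,\mu)$, complex valued. An inclusion such as $S_tL_2(K)\subset C(K)$ means that every element of the left-hand side has a representative in $C(K)$. *)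

theory Defs
  imports "HOL-Analysis.Analysis"
begin

text \<open>
  Elements of \<open>L\<^sub>p(M)\<close> are represented by functions; equality in \<open>L\<^sub>p(M)\<close> is equality
  almost everywhere.  Accordingly, an operator on \<open>L\<^sub>2(M)\<close> is a map on functions that respects
  almost everywhere equality, and all equations between its values are meant almost everywhere.
  The values of functions outside \<open>space M\<close> are irrelevant.
\<close>

definition Lp_space :: "real \<Rightarrow> 'a measure \<Rightarrow> ('a \<Rightarrow> complex) set" where
  "Lp_space p M = {f \<in> borel_measurable M. integrable M (\<lambda>x. cmod (f x) powr p)}"

definition L2_inner :: "'a measure \<Rightarrow> ('a \<Rightarrow> complex) \<Rightarrow> ('a \<Rightarrow> complex) \<Rightarrow> complex" where
  "L2_inner M u v = (\<integral>x. u x * cnj (v x) \<partial>M)"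

definition L2_norm :: "'a measure \<Rightarrow> ('a \<Rightarrow> complex) \<Rightarrow> real" where
  "L2_norm M u = sqrt (\<integral>x. (cmod (u x))\<^sup>2 \<partial>M)"

definition L2_bounded_operator :: "'a measure \<Rightarrow> (('a \<Rightarrow> complex) \<Rightarrow> 'a \<Rightarrow> complex) \<Rightarrow> bool" where
  "L2_bounded_operator M T \<longleftrightarrow>
     (\<forall>u\<in>Lp_space 2 M. T u \<in> Lp_space 2 M) \<and>
     (\<forall>u\<in>Lp_space 2 M. \<forall>v\<in>Lp_space 2 M.
        (AE x in M. u x = v x) \<longrightarrow> (AE x in M. T u x = T v x)) \<and>
     (\<forall>u\<in>Lp_space 2 M. \<forall>v\<in>Lp_space 2 M.
        AE x in M. T (\<lambda>y. u y + v y) x = T u x + T v x) \<and>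
     (\<forall>c. \<forall>u\<in>Lp_space 2 M. AE x in M. T (\<lambda>y. c * u y) x = c * T u x) \<and>
     (\<exists>C. \<forall>u\<in>Lp_space 2 M. L2_norm M (T u) \<le> C * L2_norm M u)"

text \<open>
  The Hilbert space adjoint.  The operator selected here is unique only up to almost
  everywhere equality of its values.
\<close>

definition L2_adjoint ::
  "'a measure \<Rightarrow> (('a \<Rightarrow> complex) \<Rightarrow> 'a \<Rightarrow> complex) \<Rightarrow> ('a \<Rightarrow> complex) \<Rightarrow> 'a \<Rightarrow> complex" where
  "L2_adjoint M T = (SOME T'. L2_bounded_operator M T' \<and>
     (\<forall>u\<in>Lp_space 2 M. \<forall>v\<in>Lp_space 2 M. L2_inner M (T u) v = L2_inner M u (T' v)))"

definition L2_semigroup ::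
  "'a measure \<Rightarrow> (real \<Rightarrow> ('a \<Rightarrow> complex) \<Rightarrow> 'a \<Rightarrow> complex) \<Rightarrow> bool" where
  "L2_semigroup M S \<longleftrightarrow>
     (\<forall>t>0. L2_bounded_operator M (S t)) \<and>
     (\<forall>t>0. \<forall>s>0. \<forall>u\<in>Lp_space 2 M. AE x in M. S (t + s) u x = S t (S s u) x)"

text \<open>The functions whose class modulo almost everywhere equality has a representative in \<open>C(K)\<close>.\<close>

definition continuous_classes ::
  "'a::topological_space set \<Rightarrow> 'a measure \<Rightarrow> ('a \<Rightarrow> complex) set" where
  "continuous_classes K M = {f. \<exists>g. continuous_on K g \<and> (AE x in M. f x = g x)}"

definition has_continuous_kernel ::
  "'a::topological_space set \<Rightarrow> 'a measure \<Rightarrow> (('a \<Rightarrow> complex) \<Rightarrow> 'a \<Rightarrow> complex) \<Rightarrow> bool" where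
  "has_continuous_kernel K M T \<longleftrightarrow>
     (\<exists>k. continuous_on (K \<times> K) k \<and>
        (\<forall>u\<in>Lp_space 2 M. AE x in M. T u x = (\<integral>y. k (x, y) * u y \<partial>M)))"

end

theory Submission
  imports Defs
begin

text \<open>
  An operator on \<open>L\<^sub>2\<close> that maps \<open>L\<^sub>p\<close> into \<open>C(K)\<close> is automatically bounded from \<open>L\<^sub>p\<close> to \<open>L\<^sub>\<infinity>\<close>.
  If this holds with \<open>p = p\<^sub>0\<close> for all \<open>S\<^sub>t\<close> and \<open>S\<^sub>t\<^sup>*\<close>, then interpolation with the dual estimate from \<open>L\<^sub>1\<close>
  to \<open>L\<^sub>q\<close>, \<open>1/q = 1 - 1/p\<^sub>0\<close>, shows that each \<open>S\<^sub>t\<close> improves the integrability exponent by at least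
  \<open>1/p\<^sub>0\<close>. After finitely many steps \<open>S\<^sub>t\<close> maps \<open>L\<^sub>2\<close> into \<open>L\<^bsub>p\<^sub>0\<^esub>\<close>, so one can pass from (ii) to (iii).
  Under (iii), evaluation at a point of the support of \<open>\<mu>\<close> is a bounded functional of \<open>u \<mapsto> S\<^sub>t u\<close>; its Riesz
  representative yields, after four applications of the operator, a jointly continuous kernel on the
  support, which Tietze's theorem extends to \<open>K \<times> K\<close>. The kernel of the adjoint in the remaining
  implication comes from Fubini's theorem.
\<close>

section \<open>The spaces \<open>L\<^sub>p\<close> of a finite measure\<close>

text \<open>No estimate is uniform in t: without continuity the bounds of \<open>S t\<close> may
  blow up arbitrarily as t decreases. The iteration therefore transports only membership in spaces,
  and what has to be uniform is the gain of the exponent. It is, because the gain depends only on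
  the target exponent, so that the number of halvings of t is known in advance. Since the hypotheses
  speak of membership alone, norm bounds have to be produced first; a gliding hump argument does
  this. The interpolation is carried out by truncation: it yields a weak-type bound, and giving up
  part of the exponent turns it into integrability. The second obstacle is that an L_2 class has no
  point values and that its continuous representative is unique only on the support of the measure.
  Pointwise identities are therefore asserted on the support, which has full measure, and
  representatives remain arbitrary off it.\<close>

lemma Lp_measurable [measurable_dest]: "u \<in> Lp_space p M \<Longrightarrow> u \<in> borel_measurable M"
  by (simp add: Lp_space_def)

lemma Lp_integrable: "u \<in> Lp_space p M \<Longrightarrow> integrable M (\<lambda>x. cmod (u x) powr p)"
  by (simp add: Lp_space_def)

lemma L2_iff: "u \<in> Lp_space 2 M \<longleftrightarrow> u \<in> borel_measurable M \<and> integrable M (\<lambda>x. (cmod (u x))\<^sup>2)"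
  by (simp add: Lp_space_def powr_numeral)

lemma L2_integrable: "u \<in> Lp_space 2 M \<Longrightarrow> integrable M (\<lambda>x. (cmod (u x))\<^sup>2)"
  by (simp add: L2_iff)

lemma powr_add_le:
  fixes a b :: real
  assumes "0 \<le> a" "0 \<le> b" "0 \<le> p"
  shows "(a + b) powr p \<le> 2 powr p * (a powr p + b powr p)"
proof -
  have "(a + b) powr p \<le> (2 * max a b) powr p"
    using assms by (intro powr_mono2) auto
  also have "\<dots> = 2 powr p * max a b powr p"
    using assms by (simp add: powr_mult)
  also have "max a b powr p \<le> a powr p + b powr p"
    by (auto simp: max_def)
  finally show ?thesis by simp
qed

lemma Lp_add:
  assumes "u \<in> Lp_space p M" "v \<in> Lp_space p M" "0 \<le> p"
  shows "(\<lambda>x. u x + v x) \<in> Lp_space p M"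
proof -
  have [measurable]: "u \<in> borel_measurable M" "v \<in> borel_measurable M"
    using assms by (auto simp: Lp_space_def)
  have "integrable M (\<lambda>x. 2 powr p * (cmod (u x) powr p + cmod (v x) powr p))"
    using assms by (auto simp: Lp_space_def)
  then have "integrable M (\<lambda>x. cmod (u x + v x) powr p)"
  proof (rule Bochner_Integration.integrable_bound)
    show "AE x in M. norm (cmod (u x + v x) powr p) \<le> norm (2 powr p * (cmod (u x) powr p + cmod (v x) powr p))"
    proof (intro AE_I2)
      fix x
      have "cmod (u x + v x) powr p \<le> (cmod (u x) + cmod (v x)) powr p"
        using assms by (intro powr_mono2 norm_triangle_ineq) auto
      also have "\<dots> \<le> 2 powr p * (cmod (u x) powr p + cmod (v x) powr p)"
        using assms by (intro powr_add_le) auto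
      finally show "norm (cmod (u x + v x) powr p) \<le> norm (2 powr p * (cmod (u x) powr p + cmod (v x) powr p))"
        by simp
    qed
  qed simp
  then show ?thesis by (simp add: Lp_space_def)
qed

lemma Lp_scale:
  assumes "u \<in> Lp_space p M"
  shows "(\<lambda>x. c * u x) \<in> Lp_space p M"
  using assms by (auto simp: Lp_space_def norm_mult powr_mult)

lemma Lp_diff:
  assumes "u \<in> Lp_space p M" "v \<in> Lp_space p M" "0 \<le> p"
  shows "(\<lambda>x. u x - v x) \<in> Lp_space p M"
  using Lp_add[OF assms(1) Lp_scale[OF assms(2), of "-1"] assms(3)] by simp

lemma Lp_zero [simp]: "(\<lambda>x. 0) \<in> Lp_space p M"
  by (simp add: Lp_space_def)

lemma Lp_sum:
  assumes "\<And>i. i \<in> I \<Longrightarrow> u i \<in> Lp_space p M" "0 \<le> p"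
  shows "(\<lambda>x. \<Sum>i\<in>I. u i x) \<in> Lp_space p M"
  using assms(1) by (induction I rule: infinite_finite_induct) (auto intro!: Lp_add assms(2))

lemma Lp_dominated:
  assumes "v \<in> Lp_space p M" "u \<in> borel_measurable M" "AE x in M. cmod (u x) \<le> cmod (v x)" "0 \<le> p"
  shows "u \<in> Lp_space p M"
proof -
  have "integrable M (\<lambda>x. cmod (u x) powr p)"
    using assms by (intro Bochner_Integration.integrable_bound[OF Lp_integrable[OF assms(1)]])
      (auto intro!: powr_mono2 elim!: eventually_mono)
  then show ?thesis using assms by (simp add: Lp_space_def)
qed

lemma Lp_cong:
  assumes "v \<in> Lp_space p M" "u \<in> borel_measurable M" "AE x in M. u x = v x" "0 \<le> p"
  shows "u \<in> Lp_space p M"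
  by (rule Lp_dominated[OF assms(1,2) _ assms(4)]) (use assms(3) in \<open>auto elim!: eventually_mono\<close>)

lemma (in finite_measure) Lp_bounded:
  assumes "u \<in> borel_measurable M" "AE x in M. cmod (u x) \<le> B" "0 \<le> p"
  shows "u \<in> Lp_space p M"
proof (rule Lp_dominated[OF _ assms(1) _ assms(3)])
  show "(\<lambda>x. complex_of_real B) \<in> Lp_space p M" by (simp add: Lp_space_def)
qed (use assms(2) in \<open>auto elim!: eventually_mono\<close>)

lemma powr_le_1_add_powr:
  fixes a :: real
  assumes "0 \<le> a" "0 \<le> q" "q \<le> p"
  shows "a powr q \<le> 1 + a powr p"
proof (cases "a \<le> 1")
  case True
  then have "a powr q \<le> 1" using assms by (simp add: powr_le1)
  then show ?thesis by (simp add: add_increasing2)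
next
  case False
  then have "a powr q \<le> a powr p" using assms by (intro powr_mono) auto
  then show ?thesis by simp
qed

lemma (in finite_measure) Lp_mono:
  assumes "u \<in> Lp_space p M" "0 \<le> q" "q \<le> p"
  shows "u \<in> Lp_space q M"
proof -
  have [measurable]: "u \<in> borel_measurable M" using assms by (auto simp: Lp_space_def)
  have "integrable M (\<lambda>x. 1 + cmod (u x) powr p)"
    using assms by (auto simp: Lp_space_def)
  then have "integrable M (\<lambda>x. cmod (u x) powr q)"
    using assms powr_le_1_add_powr
    by (elim Bochner_Integration.integrable_bound) auto
  then show ?thesis by (simp add: Lp_space_def)
qed

section \<open>The inner product of \<open>L\<^sub>2\<close>\<close>

lemma mult_le_sum_squares: "a * b \<le> a\<^sup>2 + b\<^sup>2" for a b :: real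
proof -
  have "0 \<le> (a - b)\<^sup>2 + a\<^sup>2 + b\<^sup>2" by simp
  then show ?thesis by (simp add: power2_diff)
qed

lemma L2_mult_integrable:
  assumes "u \<in> Lp_space 2 M" "v \<in> Lp_space 2 M"
  shows "integrable M (\<lambda>x. cmod (u x) * cmod (v x))"
proof -
  have [measurable]: "u \<in> borel_measurable M" "v \<in> borel_measurable M"
    using assms by (auto simp: Lp_space_def)
  have "integrable M (\<lambda>x. (cmod (u x))\<^sup>2 + (cmod (v x))\<^sup>2)"
    using assms by (auto simp: L2_iff)
  then show ?thesis
    by (rule Bochner_Integration.integrable_bound) (auto simp: mult_le_sum_squares)
qed

lemma L2_inner_integrable:
  assumes "u \<in> Lp_space 2 M" "v \<in> Lp_space 2 M"
  shows "integrable M (\<lambda>x. u x * cnj (v x))"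
proof -
  have [measurable]: "u \<in> borel_measurable M" "v \<in> borel_measurable M"
    using assms by (auto simp: Lp_space_def)
  have [measurable]: "(\<lambda>x. cnj (v x)) \<in> borel_measurable M"
    by (rule borel_measurable_continuous_on[where f=cnj]) (auto intro!: continuous_intros)
  show ?thesis
    by (rule Bochner_Integration.integrable_bound[OF L2_mult_integrable[OF assms]]) (auto simp: norm_mult)
qed

lemma L2_norm_nonneg [simp]: "0 \<le> L2_norm M u"
  by (simp add: L2_norm_def)

lemma L2_norm_power2: "(L2_norm M u)\<^sup>2 = (\<integral>x. (cmod (u x))\<^sup>2 \<partial>M)"
  by (simp add: L2_norm_def)

lemma L2_norm_eq_0:
  assumes "u \<in> Lp_space 2 M" "L2_norm M u = 0"
  shows "AE x in M. u x = 0"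
proof -
  have "(\<integral>x. (cmod (u x))\<^sup>2 \<partial>M) = 0"
    using assms(2) L2_norm_power2[of M u] by simp
  then have "AE x in M. (cmod (u x))\<^sup>2 = 0"
    using integral_nonneg_eq_0_iff_AE[OF L2_integrable[OF assms(1)]] by simp
  then show ?thesis by simp
qed

lemma L2_norm_cong:
  assumes "AE x in M. u x = v x" "u \<in> borel_measurable M" "v \<in> borel_measurable M"
  shows "L2_norm M u = L2_norm M v"
  unfolding L2_norm_def
  by (rule arg_cong[where f=sqrt], rule integral_cong_AE) (use assms in \<open>auto elim: eventually_mono\<close>)

lemma L2_norm_scale: "L2_norm M (\<lambda>x. c * u x) = cmod c * L2_norm M u"
  by (simp add: L2_norm_def norm_mult power_mult_distrib real_sqrt_mult)

lemma L2_Cauchy_Schwarz_real: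
  assumes "u \<in> Lp_space 2 M" "v \<in> Lp_space 2 M"
  shows "(\<integral>x. cmod (u x) * cmod (v x) \<partial>M) \<le> L2_norm M u * L2_norm M v"
proof (cases "L2_norm M u = 0 \<or> L2_norm M v = 0")
  case True
  then have "AE x in M. cmod (u x) * cmod (v x) = 0"
    using L2_norm_eq_0[OF assms(1)] L2_norm_eq_0[OF assms(2)] by (auto elim: eventually_mono)
  then have "(\<integral>x. cmod (u x) * cmod (v x) \<partial>M) = 0"
    by (rule integral_eq_zero_AE)
  then show ?thesis using True by auto
next
  case False
  define a b where "a = L2_norm M u" and "b = L2_norm M v"
  have pos: "0 < a" "0 < b" using False L2_norm_nonneg[of M u] L2_norm_nonneg[of M v]
    by (auto simp: a_def b_def less_le)
  have "(\<integral>x. 2 * (cmod (u x) * cmod (v x)) \<partial>M) \<le> (\<integral>x. (b / a) * (cmod (u x))\<^sup>2 + (a / b) * (cmod (v x))\<^sup>2 \<partial>M)"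
  proof (rule integral_mono)
    show "integrable M (\<lambda>x. 2 * (cmod (u x) * cmod (v x)))"
      using L2_mult_integrable[OF assms] by simp
    show "integrable M (\<lambda>x. (b / a) * (cmod (u x))\<^sup>2 + (a / b) * (cmod (v x))\<^sup>2)"
      using assms[THEN L2_integrable] by simp
    fix x
    have "0 \<le> (b * cmod (u x) - a * cmod (v x))\<^sup>2 / (a * b)" using pos by simp
    also have "\<dots> = (b / a) * (cmod (u x))\<^sup>2 + (a / b) * (cmod (v x))\<^sup>2 - 2 * (cmod (u x) * cmod (v x))"
      using pos by (simp add: power2_diff field_simps power2_eq_square)
    finally show "2 * (cmod (u x) * cmod (v x)) \<le> (b / a) * (cmod (u x))\<^sup>2 + (a / b) * (cmod (v x))\<^sup>2"
      by simp
  qed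
  also have "\<dots> = (b / a) * a\<^sup>2 + (a / b) * b\<^sup>2"
    using assms[THEN L2_integrable] by (simp add: a_def b_def L2_norm_power2)
  also have "\<dots> = 2 * (a * b)" using pos by (simp add: power2_eq_square)
  finally show ?thesis by (simp add: a_def b_def)
qed

lemma L2_Cauchy_Schwarz:
  assumes "u \<in> Lp_space 2 M" "v \<in> Lp_space 2 M"
  shows "cmod (L2_inner M u v) \<le> L2_norm M u * L2_norm M v"
proof -
  have "cmod (L2_inner M u v) \<le> (\<integral>x. cmod (u x * cnj (v x)) \<partial>M)"
    unfolding L2_inner_def by (rule integral_norm_bound)
  also have "\<dots> = (\<integral>x. cmod (u x) * cmod (v x) \<partial>M)" by (simp add: norm_mult)
  finally show ?thesis using L2_Cauchy_Schwarz_real[OF assms] by simp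
qed

lemma L2_inner_add_left:
  assumes "u \<in> Lp_space 2 M" "v \<in> Lp_space 2 M" "w \<in> Lp_space 2 M"
  shows "L2_inner M (\<lambda>x. u x + v x) w = L2_inner M u w + L2_inner M v w"
  unfolding L2_inner_def
  by (simp add: ring_distribs L2_inner_integrable[OF assms(1,3)] L2_inner_integrable[OF assms(2,3)])

lemma L2_inner_diff_left:
  assumes "u \<in> Lp_space 2 M" "v \<in> Lp_space 2 M" "w \<in> Lp_space 2 M"
  shows "L2_inner M (\<lambda>x. u x - v x) w = L2_inner M u w - L2_inner M v w"
  unfolding L2_inner_def
  by (simp add: ring_distribs L2_inner_integrable[OF assms(1,3)] L2_inner_integrable[OF assms(2,3)])

lemma L2_inner_add_right:
  assumes "u \<in> Lp_space 2 M" "v \<in> Lp_space 2 M" "w \<in> Lp_space 2 M"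
  shows "L2_inner M w (\<lambda>x. u x + v x) = L2_inner M w u + L2_inner M w v"
  unfolding L2_inner_def
  by (simp add: ring_distribs L2_inner_integrable[OF assms(3,1)] L2_inner_integrable[OF assms(3,2)])

lemma L2_inner_diff_right:
  assumes "u \<in> Lp_space 2 M" "v \<in> Lp_space 2 M" "w \<in> Lp_space 2 M"
  shows "L2_inner M w (\<lambda>x. u x - v x) = L2_inner M w u - L2_inner M w v"
  unfolding L2_inner_def
  by (simp add: ring_distribs L2_inner_integrable[OF assms(3,1)] L2_inner_integrable[OF assms(3,2)])

lemma L2_inner_scale_left: "L2_inner M (\<lambda>x. c * u x) w = c * L2_inner M u w"
  by (simp add: L2_inner_def mult.assoc)

lemma L2_inner_scale_right: "L2_inner M w (\<lambda>x. c * u x) = cnj c * L2_inner M w u"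
  by (simp add: L2_inner_def mult.left_commute)

lemma L2_inner_cnj: "L2_inner M u v = cnj (L2_inner M v u)"
  by (simp only: L2_inner_def Bochner_Integration.integral_cnj[symmetric] complex_cnj_mult complex_cnj_cnj mult.commute)

lemma L2_inner_self: "L2_inner M u u = of_real ((L2_norm M u)\<^sup>2)"
proof -
  have "L2_inner M u u = (\<integral>x. complex_of_real ((cmod (u x))\<^sup>2) \<partial>M)"
    unfolding L2_inner_def by (intro Bochner_Integration.integral_cong refl) (metis complex_norm_square of_real_power)
  then show ?thesis
    by (simp only: integral_complex_of_real L2_norm_power2)
qed

lemma L2_inner_cong:
  assumes "AE x in M. u x = u' x" "AE x in M. v x = v' x"
    "u \<in> Lp_space 2 M" "v \<in> Lp_space 2 M" "u' \<in> Lp_space 2 M" "v' \<in> Lp_space 2 M"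
  shows "L2_inner M u v = L2_inner M u' v'"
  unfolding L2_inner_def
proof (rule integral_cong_AE)
  show "AE x in M. u x * cnj (v x) = u' x * cnj (v' x)"
    using assms(1,2) by eventually_elim simp
qed (auto intro!: borel_measurable_integrable L2_inner_integrable assms(3-6))

lemma L2_norm_add_power2:
  assumes "u \<in> Lp_space 2 M" "v \<in> Lp_space 2 M"
  shows "(L2_norm M (\<lambda>x. u x + v x))\<^sup>2 = (L2_norm M u)\<^sup>2 + 2 * Re (L2_inner M u v) + (L2_norm M v)\<^sup>2"
proof -
  have "complex_of_real ((L2_norm M (\<lambda>x. u x + v x))\<^sup>2)
      = L2_inner M u u + (L2_inner M u v + L2_inner M v u) + L2_inner M v v"
    unfolding L2_inner_self[symmetric]
    using assms by (simp add: L2_inner_add_left L2_inner_add_right Lp_add)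
  also have "L2_inner M u v + L2_inner M v u = of_real (2 * Re (L2_inner M u v))"
    by (subst (2) L2_inner_cnj) (simp add: complex_add_cnj)
  finally have "complex_of_real ((L2_norm M (\<lambda>x. u x + v x))\<^sup>2)
      = of_real ((L2_norm M u)\<^sup>2 + 2 * Re (L2_inner M u v) + (L2_norm M v)\<^sup>2)"
    by (simp add: L2_inner_self)
  then show ?thesis using of_real_eq_iff by blast
qed

lemma L2_eqI:
  assumes "u \<in> Lp_space 2 M" "v \<in> Lp_space 2 M"
    "\<And>w. w \<in> Lp_space 2 M \<Longrightarrow> L2_inner M w u = L2_inner M w v"
  shows "AE x in M. u x = v x"
proof -
  let ?d = "\<lambda>x. u x - v x"
  have d: "?d \<in> Lp_space 2 M" using assms by (simp add: Lp_diff)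
  have "L2_inner M ?d ?d = 0"
    by (subst L2_inner_diff_right) (use assms d in auto)
  then have "L2_norm M ?d = 0" by (simp add: L2_inner_self)
  from L2_norm_eq_0[OF d this] show ?thesis by simp
qed

section \<open>Completeness and the Riesz representation\<close>

text \<open>The function \<open>g = (\<Sum>n. 2\<^sup>-\<^sup>n |v\<^sub>n|\<^sup>p)\<close> is integrable, and
  \<open>|v\<^sub>n| \<le> (2\<^sup>n g)\<^sup>1\<^sup>/\<^sup>p \<le> 2\<^sup>n g\<^sup>1\<^sup>/\<^sup>p\<close>.\<close>

lemma Lp_common_bound:
  fixes v :: "nat \<Rightarrow> 'a \<Rightarrow> complex"
  assumes p: "1 \<le> p" and v: "\<And>n. v n \<in> Lp_space p M"
    and D: "\<And>n. (\<integral>x. cmod (v n x) powr p \<partial>M) \<le> D"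
  obtains G :: "'a \<Rightarrow> real" where "G \<in> borel_measurable M" "integrable M (\<lambda>x. G x powr p)"
    "\<And>x. 0 \<le> G x" "AE x in M. \<forall>n. cmod (v n x) \<le> 2 ^ n * G x"
proof -
  have [measurable]: "v n \<in> borel_measurable M" for n using v by (simp add: Lp_space_def)
  define f where "f n x = (1/2) ^ n * cmod (v n x) powr p" for n x
  have f0: "0 \<le> f n x" for n x by (simp add: f_def)
  have fi: "integrable M (f n)" for n using Lp_integrable[OF v[of n]] by (simp add: f_def [abs_def])
  have [measurable]: "f n \<in> borel_measurable M" for n by (simp add: f_def [abs_def])
  define S where "S x = (\<Sum>n. ennreal (f n x))" for x
  have [measurable]: "S \<in> borel_measurable M" by (simp add: S_def [abs_def])
  have D0: "0 \<le> D" using D[of 0] by (rule order_trans[rotated]) simp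
  have "(\<integral>\<^sup>+x. S x \<partial>M) = (\<Sum>n. \<integral>\<^sup>+x. ennreal (f n x) \<partial>M)"
    unfolding S_def by (rule nn_integral_suminf) simp
  also have "\<dots> = (\<Sum>n. ennreal (\<integral>x. f n x \<partial>M))"
    by (intro suminf_cong nn_integral_eq_integral fi) (simp add: f0)
  also have "\<dots> \<le> (\<Sum>n. ennreal (D * (1/2) ^ n))"
  proof (intro suminf_le ennreal_leI summableI)
    fix n
    have "(\<integral>x. f n x \<partial>M) = (1/2) ^ n * (\<integral>x. cmod (v n x) powr p \<partial>M)" by (simp add: f_def)
    also have "\<dots> \<le> (1/2) ^ n * D" using D[of n] by simp
    finally show "(\<integral>x. f n x \<partial>M) \<le> D * (1/2) ^ n" by (simp add: mult.commute)
  qed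
  also have "\<dots> = ennreal (\<Sum>n. D * (1/2) ^ n)"
    using D0 by (intro suminf_ennreal_eq summable_sums) (auto intro!: summable_mult)
  also have "\<dots> < \<infinity>" by simp
  finally have fin: "(\<integral>\<^sup>+x. S x \<partial>M) < \<infinity>" .
  then have AE_fin: "AE x in M. S x \<noteq> \<infinity>"
    by (intro nn_integral_PInf_AE) auto
  define g where "g x = enn2real (S x)" for x
  have [measurable]: "g \<in> borel_measurable M" by (simp add: g_def [abs_def])
  have gi: "integrable M g"
  proof (rule integrableI_nonneg)
    have "(\<integral>\<^sup>+x. ennreal (g x) \<partial>M) \<le> (\<integral>\<^sup>+x. S x \<partial>M)"
      by (intro nn_integral_mono) (simp add: g_def ennreal_enn2real_if)
    then show "(\<integral>\<^sup>+x. ennreal (g x) \<partial>M) < \<infinity>" using fin by simp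
  qed (auto simp: g_def)
  show thesis
  proof (rule that[of "\<lambda>x. g x powr (1/p)"])
    show "integrable M (\<lambda>x. (g x powr (1/p)) powr p)"
      using gi p by (simp add: powr_powr g_def [abs_def])
    show "AE x in M. \<forall>n. cmod (v n x) \<le> 2 ^ n * g x powr (1/p)"
      using AE_fin
    proof (eventually_elim, intro allI)
      fix x n
      assume S: "S x \<noteq> \<infinity>"
      have "ennreal (f n x) \<le> S x"
        unfolding S_def using sum_le_suminf[of "\<lambda>n. ennreal (f n x)" "{n}"] by simp
      then have "f n x \<le> g x" using S f0 unfolding g_def
        by (metis enn2real_ennreal enn2real_mono infinity_ennreal_def top.not_eq_extremum)
      then have "cmod (v n x) powr p \<le> 2 ^ n * g x"
        by (simp add: f_def field_simps power_one_over)
      then have "(cmod (v n x) powr p) powr (1/p) \<le> (2 ^ n * g x) powr (1/p)"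
        using p by (intro powr_mono2) auto
      also have "(cmod (v n x) powr p) powr (1/p) = cmod (v n x)"
        using p by (simp add: powr_powr)
      also have "(2 ^ n * g x) powr (1/p) = (2 ^ n) powr (1/p) * g x powr (1/p)"
        by (simp add: powr_mult g_def)
      also have "(2 ^ n) powr (1/p) \<le> (2 ^ n :: real) powr 1"
        using p by (intro powr_mono) auto
      finally show "cmod (v n x) \<le> 2 ^ n * g x powr (1/p)"
        by (simp add: mult_right_mono)
    qed
  qed auto
qed

text \<open>Completeness enters the proof in this form. The coefficients 3^-n beat the factors 2^n
  of \<open>Lp_common_bound\<close>: the terms are dominated by \<open>(2/3) ^ n * G x\<close>,
  hence the partial sums by \<open>3 * G x\<close>. The limit lies in L_p, but convergence is
  recorded in L_2, where the operators are bounded.\<close>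

lemma (in finite_measure) L2_series:
  fixes v :: "nat \<Rightarrow> 'a \<Rightarrow> complex" and c :: "nat \<Rightarrow> complex"
  assumes p: "2 \<le> p" and v: "\<And>n. v n \<in> Lp_space p M"
    and D: "\<And>n. (\<integral>x. cmod (v n x) powr p \<partial>M) \<le> D"
    and c: "\<And>n. cmod (c n) \<le> (1/3) ^ n"
  defines "V \<equiv> (\<lambda>x. \<Sum>n. c n * v n x)"
  shows "V \<in> Lp_space p M" "(\<lambda>n. L2_norm M (\<lambda>x. (\<Sum>i<n. c i * v i x) - V x)) \<longlonglongrightarrow> 0"
proof -
  have [measurable]: "v n \<in> borel_measurable M" for n using v by (simp add: Lp_space_def)
  have [measurable]: "V \<in> borel_measurable M" by (simp add: V_def)
  have "1 \<le> p" using p by simp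
  then obtain G :: "'a \<Rightarrow> real" where G [measurable]: "G \<in> borel_measurable M"
    and Gi: "integrable M (\<lambda>x. G x powr p)" and G0: "\<And>x. 0 \<le> G x"
    and GA: "AE x in M. \<forall>n. cmod (v n x) \<le> 2 ^ n * G x"
    using Lp_common_bound[of p v M D, OF _ v D] by blast
  have bnd: "AE x in M. \<forall>n. cmod (c n * v n x) \<le> (2/3) ^ n * G x"
    using GA
  proof (eventually_elim, intro allI)
    fix x n assume "\<forall>n. cmod (v n x) \<le> 2 ^ n * G x"
    then have "cmod (c n * v n x) \<le> (1/3) ^ n * (2 ^ n * G x)"
      unfolding norm_mult using c G0 by (intro mult_mono) auto
    also have "\<dots> = (2/3) ^ n * G x"
      by (simp add: power_divide)
    finally show "cmod (c n * v n x) \<le> (2/3) ^ n * G x" .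
  qed
  have sm: "summable (\<lambda>n. (2/3) ^ n * a)" for a :: real
    by (intro summable_mult2 summable_geometric) simp
  have sv: "(\<Sum>n. (2/3) ^ n * a) = 3 * a" for a :: real
    by (subst suminf_mult2[symmetric]) (auto intro!: summable_geometric simp: suminf_geometric)
  have AEs: "AE x in M. summable (\<lambda>n. cmod (c n * v n x)) \<and> (\<Sum>n. cmod (c n * v n x)) \<le> 3 * G x"
    using bnd
  proof eventually_elim
    case (elim x)
    have s: "summable (\<lambda>n. cmod (c n * v n x))"
      by (rule summable_comparison_test'[OF sm[of "G x"], of 0]) (use elim in auto)
    moreover have "(\<Sum>n. cmod (c n * v n x)) \<le> (\<Sum>n. (2/3) ^ n * G x)"
      by (rule suminf_le) (use elim s sm in auto)
    ultimately show ?case by (simp add: sv)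
  qed
  have part: "AE x in M. \<forall>n. cmod (\<Sum>i<n. c i * v i x) \<le> 3 * G x"
    using AEs
  proof (eventually_elim, intro allI)
    fix x n
    assume *: "summable (\<lambda>n. cmod (c n * v n x)) \<and> (\<Sum>n. cmod (c n * v n x)) \<le> 3 * G x"
    have "cmod (\<Sum>i<n. c i * v i x) \<le> (\<Sum>i<n. cmod (c i * v i x))" by (rule norm_sum)
    also have "\<dots> \<le> (\<Sum>n. cmod (c n * v n x))" using * by (intro sum_le_suminf) auto
    finally show "cmod (\<Sum>i<n. c i * v i x) \<le> 3 * G x" using * by simp
  qed
  have lim: "AE x in M. (\<lambda>n. \<Sum>i<n. c i * v i x) \<longlonglongrightarrow> V x"
    using AEs
  proof eventually_elim
    case (elim x)
    then have "summable (\<lambda>n. c n * v n x)" by (auto intro: summable_norm_cancel)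
    then show ?case unfolding V_def by (rule summable_LIMSEQ)
  qed
  have VG: "AE x in M. cmod (V x) \<le> 3 * G x"
    using part lim
  proof eventually_elim
    case (elim x)
    show ?case
      by (rule tendsto_upperbound[OF tendsto_norm[OF elim(2)]]) (use elim in auto)
  qed
  have GL: "(\<lambda>x. complex_of_real (3 * G x)) \<in> Lp_space p M"
    using Gi G0 by (auto simp: Lp_space_def powr_mult norm_mult)
  show V: "V \<in> Lp_space p M"
  proof (rule Lp_dominated[OF GL])
    show "AE x in M. cmod (V x) \<le> cmod (complex_of_real (3 * G x))"
      using VG by eventually_elim (use G0 in \<open>simp add: norm_mult\<close>)
  qed (use p in auto)
  have "(\<lambda>x. complex_of_real (3 * G x)) \<in> Lp_space 2 M"
    using GL p by (intro Lp_mono[OF GL]) auto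
  then have G2: "integrable M (\<lambda>x. (G x)\<^sup>2)"
    by (simp add: L2_iff norm_mult power_mult_distrib)
  have "(\<lambda>n. \<integral>x. (cmod ((\<Sum>i<n. c i * v i x) - V x))\<^sup>2 \<partial>M) \<longlonglongrightarrow> (\<integral>x. 0 \<partial>M)"
  proof (rule integral_dominated_convergence)
    show "integrable M (\<lambda>x. 36 * (G x)\<^sup>2)" using G2 by simp
    show "AE x in M. (\<lambda>n. (cmod ((\<Sum>i<n. c i * v i x) - V x))\<^sup>2) \<longlonglongrightarrow> 0"
      using lim
    proof eventually_elim
      case (elim x)
      then have "(\<lambda>n. (\<Sum>i<n. c i * v i x) - V x) \<longlonglongrightarrow> 0" by (simp add: LIM_zero)
      then show ?case by (metis tendsto_norm_zero tendsto_null_power zero_less_numeral)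
    qed
    show "AE x in M. norm ((cmod ((\<Sum>i<n. c i * v i x) - V x))\<^sup>2) \<le> 36 * (G x)\<^sup>2" for n
      using part VG
    proof eventually_elim
      case (elim x)
      have "cmod ((\<Sum>i<n. c i * v i x) - V x) \<le> 6 * G x"
        using norm_triangle_ineq4[of "\<Sum>i<n. c i * v i x" "V x"] elim by (smt (verit))
      then have "(cmod ((\<Sum>i<n. c i * v i x) - V x))\<^sup>2 \<le> (6 * G x)\<^sup>2"
        by (intro power_mono) auto
      then show ?case by (simp add: power_mult_distrib)
    qed
  qed auto
  then show "(\<lambda>n. L2_norm M (\<lambda>x. (\<Sum>i<n. c i * v i x) - V x)) \<longlonglongrightarrow> 0"
    unfolding L2_norm_def by (intro tendsto_eq_intros) auto
qed

lemma L2_inner_tendsto_left: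
  assumes "\<And>n. u n \<in> Lp_space 2 M" "v \<in> Lp_space 2 M" "h \<in> Lp_space 2 M"
    "(\<lambda>n. L2_norm M (\<lambda>x. u n x - v x)) \<longlonglongrightarrow> 0"
  shows "(\<lambda>n. L2_inner M (u n) h) \<longlonglongrightarrow> L2_inner M v h"
proof (rule LIM_zero_cancel, rule Lim_null_comparison)
  show "\<forall>\<^sub>F n in sequentially. norm (L2_inner M (u n) h - L2_inner M v h)
      \<le> L2_norm M (\<lambda>x. u n x - v x) * L2_norm M h"
    using L2_Cauchy_Schwarz[OF Lp_diff[OF assms(1,2)] assms(3)] assms(1-3)
    by (simp add: L2_inner_diff_left)
  show "(\<lambda>n. L2_norm M (\<lambda>x. u n x - v x) * L2_norm M h) \<longlonglongrightarrow> 0"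
    using tendsto_mult_right[OF assms(4), of "L2_norm M h"] by simp
qed

text \<open>The representative is the minimiser of \<open>Q\<close>: if F u = <u, k>, then Q u = |u
  - k|^2 - |k|^2. The parallelogram identity makes minimising sequences Cauchy, and the vanishing
  first variation at the minimiser is the claimed identity.\<close>

lemma (in finite_measure) L2_Riesz:
  fixes F :: "('a \<Rightarrow> complex) \<Rightarrow> complex"
  assumes add: "\<And>u v. u \<in> Lp_space 2 M \<Longrightarrow> v \<in> Lp_space 2 M \<Longrightarrow> F (\<lambda>x. u x + v x) = F u + F v"
    and scale: "\<And>c u. u \<in> Lp_space 2 M \<Longrightarrow> F (\<lambda>x. c * u x) = c * F u"
    and bound: "\<And>u. u \<in> Lp_space 2 M \<Longrightarrow> cmod (F u) \<le> B * L2_norm M u"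
  obtains k where "k \<in> Lp_space 2 M" "\<And>u. u \<in> Lp_space 2 M \<Longrightarrow> F u = L2_inner M u k"
proof -
  let ?L = "Lp_space 2 M"
  define Q where "Q u = (L2_norm M u)\<^sup>2 - 2 * Re (F u)" for u
  have Qlow: "- B\<^sup>2 \<le> Q u" if "u \<in> ?L" for u
  proof -
    have "Re (F u) \<le> B * L2_norm M u"
      using bound[OF that] complex_Re_le_cmod order_trans by blast
    moreover have "0 \<le> (L2_norm M u - B)\<^sup>2" by simp
    ultimately show ?thesis by (simp add: Q_def power2_diff algebra_simps)
  qed
  have Qadd: "Q (\<lambda>x. u x + c * h x) = Q u + (cmod c)\<^sup>2 * (L2_norm M h)\<^sup>2
      + 2 * Re (c * (L2_inner M h u - F h))" if "u \<in> ?L" "h \<in> ?L" for u h c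
  proof -
    have "Re (cnj c * L2_inner M u h) = Re (c * L2_inner M h u)"
      by (subst L2_inner_cnj) (metis complex_cnj_cnj complex_cnj_mult cnj.simps(1))
    then show ?thesis
      using that by (simp add: Q_def L2_norm_add_power2 Lp_scale add scale L2_norm_scale
          L2_inner_scale_right power_mult_distrib right_diff_distrib)
  qed
  define m where "m = Inf (Q ` ?L)"
  have bdd: "bdd_below (Q ` ?L)" using Qlow by (intro bdd_belowI[of _ "- B\<^sup>2"]) auto
  have ne: "Q ` ?L \<noteq> {}" using Lp_zero by blast
  have mle: "m \<le> Q u" if "u \<in> ?L" for u
    unfolding m_def using that bdd by (intro cInf_lower) auto
  \<comment> \<open>The rate 9^-n gives consecutive differences of norm O(3^-n). Rescaled by 3^n
    they form the bounded sequence \<open>v\<close>, and \<open>L2_series\<close> with coefficients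
    3^-n sums them back by telescoping.\<close>
  have "\<exists>u\<in>?L. Q u < m + (1/9) ^ n" for n :: nat
  proof -
    have "Inf (Q ` ?L) < m + (1/9) ^ n" by (simp add: m_def)
    then show ?thesis using cInf_lessD[OF ne] by auto
  qed
  then obtain u where uL: "\<And>n. u n \<in> ?L" and uQ: "\<And>n. Q (u n) < m + (1/9) ^ n"
    by metis
  define v where "v n x = 3 ^ n * (u (Suc n) x - u n x)" for n x
  have vL: "v n \<in> ?L" for n
    unfolding v_def by (intro Lp_scale Lp_diff uL) simp
  have "(\<integral>x. cmod (v n x) powr 2 \<partial>M) \<le> 4" for n
  proof -
    \<comment> \<open>Midpoint and half difference of consecutive members: \<open>Qadd\<close> with
      \<open>c = 1\<close> and \<open>c = -1\<close> is the parallelogram identity, and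
      \<open>m \<le> Q a\<close> bounds the half difference.\<close>
    define a d where "a x = (1/2) * (u (Suc n) x + u n x)"
      and "d x = (1/2) * (u (Suc n) x - u n x)" for x
    have aL: "a \<in> ?L" unfolding a_def by (intro Lp_scale Lp_add uL) simp
    have dL: "d \<in> ?L" unfolding d_def by (intro Lp_scale Lp_diff uL) simp
    have "Q (u (Suc n)) + Q (u n) = Q (\<lambda>x. a x + 1 * d x) + Q (\<lambda>x. a x + (-1) * d x)"
      by (simp add: a_def d_def field_simps)
    also have "\<dots> = 2 * Q a + 2 * (L2_norm M d)\<^sup>2"
      unfolding Qadd[OF aL dL] by simp
    finally have "2 * (L2_norm M d)\<^sup>2 \<le> (1/9) ^ n + (1/9) ^ Suc n"
      using mle[OF aL] uQ[of n] uQ[of "Suc n"] by linarith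
    moreover have "(1/9) ^ Suc n \<le> (1/9 :: real) ^ n" by simp
    ultimately have dn: "(L2_norm M d)\<^sup>2 \<le> (1/9) ^ n" by linarith
    have "v n = (\<lambda>x. (2 * 3 ^ n) * d x)" by (simp add: v_def d_def fun_eq_iff)
    then have "L2_norm M (v n) = (2 * 3 ^ n) * L2_norm M d"
      by (simp only: L2_norm_scale) (simp add: norm_mult norm_power)
    then have "(L2_norm M (v n))\<^sup>2 = 4 * 9 ^ n * (L2_norm M d)\<^sup>2"
      by (simp add: power_mult_distrib power2_eq_square flip: power_mult_distrib)
    also have "\<dots> \<le> 4 * 9 ^ n * (1/9) ^ n" using dn by (intro mult_left_mono) auto
    also have "\<dots> = 4" by (simp add: power_one_over)
    finally show ?thesis by (simp add: L2_norm_power2)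
  qed
  note ser = L2_series[OF order_refl vL this, of "\<lambda>n. (1/3) ^ n"]
  define V where "V x = (\<Sum>n. (1/3) ^ n * v n x)" for x
  have VL: "V \<in> ?L" unfolding V_def using ser(1) by (simp add: norm_power)
  have lim: "(\<lambda>n. L2_norm M (\<lambda>x. (\<Sum>i<n. (1/3) ^ i * v i x) - V x)) \<longlonglongrightarrow> 0"
    unfolding V_def using ser(2) by (simp add: norm_power)
  define k where "k x = u 0 x + V x" for x
  have kL: "k \<in> ?L" unfolding k_def by (intro Lp_add uL VL) simp
  have tele: "(\<Sum>i<n. (1/3) ^ i * v i x) = u n x - u 0 x" for n x
    by (induction n) (auto simp: v_def power_one_over)
  have lim: "(\<lambda>n. L2_norm M (\<lambda>x. u n x - k x)) \<longlonglongrightarrow> 0"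
    using lim unfolding tele k_def by (simp add: algebra_simps)
  show thesis
  proof (rule that[OF kL])
    fix h assume h: "h \<in> ?L"
    define z where "z = L2_inner M h k - F h"
    have l: "(\<lambda>n. L2_inner M h (u n)) \<longlonglongrightarrow> L2_inner M h k"
      using tendsto_cnj[OF L2_inner_tendsto_left[OF uL kL h lim]] by (simp flip: L2_inner_cnj)
    \<comment> \<open>Near-minimality passes to the limit: \<open>Q (u n)\<close> exceeds the value
      of \<open>Q\<close> at any perturbation of \<open>u n\<close> by less than 9^-n.\<close>
    have key: "0 \<le> (cmod c)\<^sup>2 * (L2_norm M h)\<^sup>2 + 2 * Re (c * z)" for c
    proof (rule LIMSEQ_le)
      show "(\<lambda>n. - ((1/9) ^ n)) \<longlonglongrightarrow> (0::real)"
        by (rule tendsto_eq_intros LIMSEQ_realpow_zero | simp)+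
      show "(\<lambda>n. (cmod c)\<^sup>2 * (L2_norm M h)\<^sup>2 + 2 * Re (c * (L2_inner M h (u n) - F h)))
          \<longlonglongrightarrow> (cmod c)\<^sup>2 * (L2_norm M h)\<^sup>2 + 2 * Re (c * z)"
        unfolding z_def by (intro tendsto_intros l)
      have "- ((1/9) ^ n) \<le> (cmod c)\<^sup>2 * (L2_norm M h)\<^sup>2 + 2 * Re (c * (L2_inner M h (u n) - F h))" for n
        using mle[OF Lp_add[OF uL Lp_scale[OF h, of c]], of n] uQ[of n]
        unfolding Qadd[OF uL h] by simp
      then show "\<exists>N. \<forall>n\<ge>N. - ((1/9) ^ n) \<le> (cmod c)\<^sup>2 * (L2_norm M h)\<^sup>2
          + 2 * Re (c * (L2_inner M h (u n) - F h))" by blast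
    qed
    \<comment> \<open>For \<open>c = - of_real s * cnj z\<close> the quadratic in \<open>key\<close>
      equals s |z|^2 (s H - 2), which is negative unless \<open>z = 0\<close>. Adding 1 to
      \<open>H\<close> covers a null \<open>h\<close>.\<close>
    define H s where "H = (L2_norm M h)\<^sup>2" and "s = 1 / (H + 1)"
    have H0: "0 \<le> H" by (simp add: H_def)
    have s: "0 < s" "s * H < 2" using H0 by (auto simp: s_def field_simps)
    have "Re (- of_real s * cnj z * z) = - s * (cmod z)\<^sup>2"
      by (simp add: mult.assoc flip: complex_norm_square) (simp add: mult.commute cmod_power2 flip: power2_eq_square)
    then have "0 \<le> (s * cmod z)\<^sup>2 * H - 2 * s * (cmod z)\<^sup>2"
      using key[of "- of_real s * cnj z"] s by (simp add: norm_mult H_def)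
    also have "\<dots> = (s * (cmod z)\<^sup>2) * (s * H - 2)" by (simp add: power2_eq_square algebra_simps)
    finally have "(cmod z)\<^sup>2 \<le> 0" using s
      by (smt (verit) mult_pos_neg mult_pos_pos zero_le_power2)
    then show "F h = L2_inner M h k" by (simp add: z_def)
  qed
qed

section \<open>Bounded operators and adjoints\<close>

lemma L2_bounded_operatorD:
  assumes "L2_bounded_operator M T"
  shows "\<And>u. u \<in> Lp_space 2 M \<Longrightarrow> T u \<in> Lp_space 2 M"
    "\<And>u v. u \<in> Lp_space 2 M \<Longrightarrow> v \<in> Lp_space 2 M \<Longrightarrow> AE x in M. u x = v x \<Longrightarrow> AE x in M. T u x = T v x"
    "\<And>u v. u \<in> Lp_space 2 M \<Longrightarrow> v \<in> Lp_space 2 M \<Longrightarrow> AE x in M. T (\<lambda>y. u y + v y) x = T u x + T v x"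
    "\<And>c u. u \<in> Lp_space 2 M \<Longrightarrow> AE x in M. T (\<lambda>y. c * u y) x = c * T u x"
  using assms unfolding L2_bounded_operator_def by blast+

lemma L2_bounded_operator_bound:
  assumes "L2_bounded_operator M T"
  obtains C where "0 \<le> C" "\<And>u. u \<in> Lp_space 2 M \<Longrightarrow> L2_norm M (T u) \<le> C * L2_norm M u"
proof -
  obtain C where C: "\<And>u. u \<in> Lp_space 2 M \<Longrightarrow> L2_norm M (T u) \<le> C * L2_norm M u"
    using assms unfolding L2_bounded_operator_def by blast
  show thesis
  proof (rule that[of "\<bar>C\<bar>"])
    fix u assume "u \<in> Lp_space 2 M"
    then have "L2_norm M (T u) \<le> C * L2_norm M u" by (rule C)
    also have "\<dots> \<le> \<bar>C\<bar> * L2_norm M u" by (intro mult_right_mono) auto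
    finally show "L2_norm M (T u) \<le> \<bar>C\<bar> * L2_norm M u" .
  qed simp
qed

lemma L2_bounded_operator_diff:
  assumes T: "L2_bounded_operator M T" and "u \<in> Lp_space 2 M" "v \<in> Lp_space 2 M"
  shows "AE x in M. T (\<lambda>y. u y - v y) x = T u x - T v x"
proof -
  note T' = L2_bounded_operatorD[OF T]
  have "AE x in M. T (\<lambda>y. u y + (-1) * v y) x = T u x + T (\<lambda>y. (-1) * v y) x"
    using assms by (intro T' Lp_scale)
  moreover have "AE x in M. T (\<lambda>y. (-1) * v y) x = (-1) * T v x"
    using assms by (intro T')
  ultimately show ?thesis by eventually_elim simp
qed

lemma L2_inner_operator_add:
  assumes T: "L2_bounded_operator M T" and "u \<in> Lp_space 2 M" "v \<in> Lp_space 2 M" "h \<in> Lp_space 2 M"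
  shows "L2_inner M (T (\<lambda>y. u y + v y)) h = L2_inner M (T u) h + L2_inner M (T v) h"
proof -
  note T' = L2_bounded_operatorD[OF T]
  have "L2_inner M (T (\<lambda>y. u y + v y)) h = L2_inner M (\<lambda>x. T u x + T v x) h"
    by (rule L2_inner_cong) (use assms in \<open>auto intro!: Lp_add T'\<close>)
  then show ?thesis using assms T' by (simp add: L2_inner_add_left)
qed

lemma L2_inner_operator_scale:
  assumes T: "L2_bounded_operator M T" and "u \<in> Lp_space 2 M" "h \<in> Lp_space 2 M"
  shows "L2_inner M (T (\<lambda>y. c * u y)) h = c * L2_inner M (T u) h"
proof -
  note T' = L2_bounded_operatorD[OF T]
  have "L2_inner M (T (\<lambda>y. c * u y)) h = L2_inner M (\<lambda>x. c * T u x) h"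
    by (rule L2_inner_cong) (use assms in \<open>auto intro!: Lp_scale T'\<close>)
  then show ?thesis by (simp add: L2_inner_scale_left)
qed

text \<open>\<open>R v\<close> is the Riesz representative of u \<mapsto> <T u, v>. It is chosen
  arbitrarily within its class, so linearity of \<open>R\<close> is obtained almost everywhere, by
  testing; its bound comes from |R u|^2 = <T (R u), u>.\<close>

lemma (in finite_measure) L2_adjoint_exists:
  assumes T: "L2_bounded_operator M T"
  obtains T' where "L2_bounded_operator M T'"
    "\<And>u v. u \<in> Lp_space 2 M \<Longrightarrow> v \<in> Lp_space 2 M \<Longrightarrow> L2_inner M (T u) v = L2_inner M u (T' v)"
proof -
  let ?L = "Lp_space 2 M"
  note T' = L2_bounded_operatorD[OF T]
  obtain C where C: "0 \<le> C" "\<And>u. u \<in> ?L \<Longrightarrow> L2_norm M (T u) \<le> C * L2_norm M u"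
    using L2_bounded_operator_bound[OF T] by blast
  have "\<exists>w\<in>?L. \<forall>u\<in>?L. L2_inner M (T u) v = L2_inner M u w" if v: "v \<in> ?L" for v
  proof -
    have "cmod (L2_inner M (T u) v) \<le> (C * L2_norm M v) * L2_norm M u" if u: "u \<in> ?L" for u
      using L2_Cauchy_Schwarz[OF T'(1)[OF u] v] mult_right_mono[OF C(2)[OF u], of "L2_norm M v"]
      by (simp add: mult_ac)
    then obtain w where "w \<in> ?L" "\<And>u. u \<in> ?L \<Longrightarrow> L2_inner M (T u) v = L2_inner M u w"
      using L2_Riesz[of "\<lambda>u. L2_inner M (T u) v" "C * L2_norm M v",
          OF L2_inner_operator_add[OF T _ _ v] L2_inner_operator_scale[OF T _ v]] by blast
    then show ?thesis by blast
  qed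
  then obtain R where R: "\<And>v. v \<in> ?L \<Longrightarrow> R v \<in> ?L"
    "\<And>u v. v \<in> ?L \<Longrightarrow> u \<in> ?L \<Longrightarrow> L2_inner M (T u) v = L2_inner M u (R v)"
    by metis
  have "L2_bounded_operator M R"
    unfolding L2_bounded_operator_def
  proof (intro conjI ballI allI impI)
    show "R u \<in> ?L" if "u \<in> ?L" for u using R(1) that .
    show "AE x in M. R u x = R v x" if "u \<in> ?L" "v \<in> ?L" "AE x in M. u x = v x" for u v
    proof (rule L2_eqI[OF R(1)[OF that(1)] R(1)[OF that(2)]])
      fix w assume w: "w \<in> ?L"
      have "L2_inner M (T w) u = L2_inner M (T w) v"
        by (rule L2_inner_cong) (use that w T' in auto)
      then show "L2_inner M w (R u) = L2_inner M w (R v)" using R(2) that w by simp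
    qed
    show "AE x in M. R (\<lambda>y. u y + v y) x = R u x + R v x" if "u \<in> ?L" "v \<in> ?L" for u v
      by (rule L2_eqI) (use that in \<open>simp_all add: R Lp_add L2_inner_add_right T' flip: R(2)\<close>)
    show "AE x in M. R (\<lambda>y. c * u y) x = c * R u x" if "u \<in> ?L" for u c
      by (rule L2_eqI) (use that in \<open>simp_all add: R Lp_scale L2_inner_scale_right T' flip: R(2)\<close>)
    show "\<exists>C. \<forall>u\<in>?L. L2_norm M (R u) \<le> C * L2_norm M u"
    proof (intro exI ballI)
      fix u assume u: "u \<in> ?L"
      have "(L2_norm M (R u))\<^sup>2 = cmod (L2_inner M (R u) (R u))"
        by (simp add: L2_inner_self norm_power)
      also have "\<dots> = cmod (L2_inner M (T (R u)) u)" using R u by simp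
      also have "\<dots> \<le> L2_norm M (T (R u)) * L2_norm M u"
        by (intro L2_Cauchy_Schwarz T' R u)
      also have "\<dots> \<le> C * L2_norm M (R u) * L2_norm M u"
        by (intro mult_right_mono C R u) simp
      finally have "L2_norm M (R u) * L2_norm M (R u) \<le> L2_norm M (R u) * (C * L2_norm M u)"
        by (simp add: power2_eq_square mult_ac)
      then show "L2_norm M (R u) \<le> C * L2_norm M u"
        using C(1) L2_norm_nonneg[of M "R u"] L2_norm_nonneg[of M u]
        by (cases "L2_norm M (R u) = 0") (auto simp: less_le)
    qed
  qed
  then show thesis using that R(2) by blast
qed

lemma (in finite_measure) L2_adjoint:
  assumes "L2_bounded_operator M T"
  shows "L2_bounded_operator M (L2_adjoint M T)"
    "u \<in> Lp_space 2 M \<Longrightarrow> v \<in> Lp_space 2 M \<Longrightarrow> L2_inner M (T u) v = L2_inner M u (L2_adjoint M T v)"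
proof -
  have "\<exists>T'. L2_bounded_operator M T' \<and>
     (\<forall>u\<in>Lp_space 2 M. \<forall>v\<in>Lp_space 2 M. L2_inner M (T u) v = L2_inner M u (T' v))"
    using L2_adjoint_exists[OF assms] by metis
  from someI_ex[OF this, folded L2_adjoint_def]
  show "L2_bounded_operator M (L2_adjoint M T)"
    "u \<in> Lp_space 2 M \<Longrightarrow> v \<in> Lp_space 2 M \<Longrightarrow> L2_inner M (T u) v = L2_inner M u (L2_adjoint M T v)"
    by blast+
qed

section \<open>Automatic boundedness\<close>

text \<open>Let c_j = 3^-j up to a sign. One of the two signs makes the partial sum of row j up to
  the diagonal at least as large as its last term, hence at least 3/4 of 3^-j N_j. The later terms
  together take away at most the sum of 3^-i N_j over i > j, which is half of 3^-j N_j, so a quarter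
  survives.\<close>

lemma gliding_hump_signs:
  fixes a :: "nat \<Rightarrow> nat \<Rightarrow> complex" and N :: "nat \<Rightarrow> real"
  assumes le: "\<And>j i. cmod (a j i) \<le> N j" and diag: "\<And>j. 3/4 * N j \<le> cmod (a j j)"
  obtains c :: "nat \<Rightarrow> complex" where "\<And>i. cmod (c i) \<le> (1/3) ^ i"
    "\<And>j n. j < n \<Longrightarrow> (1/3) ^ j * N j / 4 \<le> cmod (\<Sum>i<n. c i * a j i)"
proof -
  define P where "P c j r \<longleftrightarrow> cmod r = (1/3) ^ j \<and>
      (1/3) ^ j * (3/4 * N j) \<le> cmod ((\<Sum>i<j. c i * a j i) + r * a j j)" for c and j :: nat and r
  have "\<exists>c. \<forall>j. P c j (c j)"
  proof (rule dependent_wellorder_choice)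
    show "P f j r = P g j r" if "\<And>i. i < j \<Longrightarrow> f i = g i" for r f g j
    proof -
      have "(\<Sum>i<j. f i * a j i) = (\<Sum>i<j. g i * a j i)" using that by (intro sum.cong) auto
      then show ?thesis by (simp add: P_def)
    qed
    show "\<exists>r. P c j r" for c j
    proof -
      define s where "s = (\<Sum>i<j. c i * a j i)"
      define r :: complex where "r = (1/3) ^ j"
      have r: "cmod r = (1/3) ^ j" by (simp add: r_def norm_power)
      have "2 * cmod (r * a j j) = cmod ((s + r * a j j) - (s + (- r) * a j j))"
        by (simp flip: norm_mult_numeral1)
      also have "\<dots> \<le> cmod (s + r * a j j) + cmod (s + (- r) * a j j)"
        by (rule norm_triangle_ineq4)
      finally have "cmod (r * a j j) \<le> cmod (s + r * a j j) \<or> cmod (r * a j j) \<le> cmod (s + (- r) * a j j)"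
        by linarith
      moreover have "(1/3) ^ j * (3/4 * N j) \<le> cmod (r * a j j)"
        unfolding norm_mult r by (intro mult_left_mono diag) simp
      ultimately have "P c j r \<or> P c j (- r)"
        unfolding P_def s_def[symmetric] by (auto simp: r)
      then show ?thesis by blast
    qed
  qed
  then obtain c where c: "\<And>j. P c j (c j)" by blast
  have N0: "0 \<le> N j" for j using le[of j 0] norm_ge_zero order_trans by blast
  have nc: "cmod (c j) = (1/3) ^ j" for j using c by (simp add: P_def)
  \<comment> \<open>The summand with \<open>(1/3) ^ k\<close> is the reserve for the coefficients
    not yet added, the tail of a geometric series of ratio 1/3; for \<open>k = 0\<close> both
    summands add up to the bound 3/4 in \<open>P\<close>.\<close>
  have "(1/3) ^ j * N j / 4 + (1/3) ^ k * (1/3) ^ j * N j / 2 \<le> cmod (\<Sum>i<Suc (j + k). c i * a j i)" for j k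
  proof (induction k)
    case 0
    show ?case using c[of j] by (simp add: P_def mult_ac)
  next
    case (Suc k)
    let ?n = "Suc (j + k)"
    have "cmod (c ?n * a j ?n) \<le> (1/3) ^ ?n * N j"
      unfolding norm_mult nc by (intro mult_left_mono le) simp
    moreover have "cmod (\<Sum>i<?n. c i * a j i) \<le> cmod (\<Sum>i<Suc ?n. c i * a j i) + cmod (c ?n * a j ?n)"
      using norm_triangle_ineq4[of "\<Sum>i<Suc ?n. c i * a j i" "c ?n * a j ?n"] by simp
    moreover have "(1/3) ^ ?n * N j = (1/3) ^ k * (1/3) ^ j * N j / 3"
      by (simp add: power_add)
    moreover have "(1/3) ^ Suc k * (1/3) ^ j * N j / 2 = (1/3) ^ k * (1/3) ^ j * N j / 6"
      by simp
    ultimately have "(1/3) ^ j * N j / 4 + (1/3) ^ Suc k * (1/3) ^ j * N j / 2 \<le> cmod (\<Sum>i<Suc ?n. c i * a j i)"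
      using Suc.IH by linarith
    then show ?case by simp
  qed note est = this
  show thesis
  proof (rule that[of c])
    fix j n :: nat assume "j < n"
    then obtain k where n: "n = Suc (j + k)" using less_imp_Suc_add by blast
    have "0 \<le> (1/3) ^ k * (1/3) ^ j * N j / 2" using N0 by simp
    then show "(1/3) ^ j * N j / 4 \<le> cmod (\<Sum>i<n. c i * a j i)"
      using est[of j k] unfolding n by linarith
  qed (simp add: nc)
qed

text \<open>\<open>h\<close> is the phase of \<open>g\<close> on the set where |g| exceeds
  \<open>A\<close>, divided by the measure of that set. Its L_1 norm is at most 1, so testing with
  it never exceeds an essential bound, while its boundedness puts it into L_2. Failure of an
  essential bound is thus detected by functionals that are continuous on L_2.\<close>

lemma (in finite_measure) essential_bound_test:
  assumes g: "g \<in> Lp_space 2 M" and not: "\<not> (AE x in M. cmod (g x) \<le> A)"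
  obtains h where "h \<in> Lp_space 2 M" "A \<le> cmod (L2_inner M g h)"
    "\<And>w B. w \<in> Lp_space 2 M \<Longrightarrow> AE x in M. cmod (w x) \<le> B \<Longrightarrow> cmod (L2_inner M w h) \<le> B"
proof -
  have [measurable]: "g \<in> borel_measurable M" using g by (simp add: Lp_space_def)
  define E where "E = {x \<in> space M. A < cmod (g x)}"
  have [measurable]: "E \<in> sets M" by (simp add: E_def)
  define m where "m = measure M E"
  have "emeasure M E \<noteq> 0"
  proof
    assume "emeasure M E = 0"
    then have "AE x in M. x \<notin> E" by (intro AE_not_in) auto
    then have "AE x in M. cmod (g x) \<le> A"
      using AE_space by eventually_elim (auto simp: E_def)
    with not show False by simp
  qed
  then have m: "0 < m"
    unfolding m_def emeasure_eq_measure by (metis ennreal_0 measure_nonneg less_le)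
  define h where "h x = (indicator E x / m) *\<^sub>R sgn (g x)" for x
  have hm [measurable]: "h \<in> borel_measurable M" by (simp add: h_def [abs_def])
  have hb: "cmod (h x) \<le> indicator E x / m" for x
    using m by (auto simp: h_def norm_sgn indicator_def)
  have "cmod (h x) \<le> 1 / m" for x
    by (rule order_trans[OF hb]) (use m in \<open>auto simp: indicator_def\<close>)
  then have h: "h \<in> Lp_space 2 M" by (intro Lp_bounded[of _ "1/m"]) auto
  have ind: "integrable M (\<lambda>x. B * (indicator E x / m))" "(\<integral>x. B * (indicator E x / m) \<partial>M) = B" for B :: real
  proof -
    have "integrable M (\<lambda>x. (B / m) * indicator E x)"
      by (intro integrable_mult_right) (simp add: emeasure_eq_measure)
    then show "integrable M (\<lambda>x. B * (indicator E x / m))" by simp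
    show "(\<integral>x. B * (indicator E x / m) \<partial>M) = B" using m by (simp add: m_def)
  qed
  show thesis
  proof (rule that[OF h])
    have gh: "g x * cnj (h x) = of_real (cmod (g x) * (indicator E x / m))" for x
    proof -
      have "g x * cnj (sgn (g x)) = of_real (cmod (g x))"
        by (cases "g x = 0")
          (simp_all add: sgn_eq complex_norm_square[symmetric] power2_eq_square)
      then show ?thesis by (simp add: h_def scaleR_conv_of_real mult.left_commute mult.commute)
    qed
    have "A = (\<integral>x. A * (indicator E x / m) \<partial>M)" using ind by simp
    also have "\<dots> \<le> (\<integral>x. cmod (g x) * (indicator E x / m) \<partial>M)"
    proof (rule integral_mono[OF ind(1)])
      have "integrable M (\<lambda>x. complex_of_real (cmod (g x) * (indicator E x / m)))"
        using L2_inner_integrable[OF g h] by (simp only: gh)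
      then show "integrable M (\<lambda>x. cmod (g x) * (indicator E x / m))"
        by (simp only: complex_of_real_integrable_eq)
      show "A * (indicator E x / m) \<le> cmod (g x) * (indicator E x / m)" for x
        using m by (auto simp: E_def indicator_def divide_right_mono)
    qed
    also have "\<dots> = Re (L2_inner M g h)"
      unfolding L2_inner_def gh by (simp only: integral_complex_of_real Re_complex_of_real)
    also have "\<dots> \<le> cmod (L2_inner M g h)" by (rule complex_Re_le_cmod)
    finally show "A \<le> cmod (L2_inner M g h)" .
  next
    fix w B assume w: "w \<in> Lp_space 2 M" and B: "AE x in M. cmod (w x) \<le> B"
    have "cmod (L2_inner M w h) \<le> (\<integral>x. cmod (w x * cnj (h x)) \<partial>M)"
      unfolding L2_inner_def by (rule integral_norm_bound)
    also have "\<dots> \<le> (\<integral>x. B * (indicator E x / m) \<partial>M)"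
    proof (rule integral_mono_AE)
      show "AE x in M. cmod (w x * cnj (h x)) \<le> B * (indicator E x / m)"
        using B
      proof eventually_elim
        case (elim x)
        then have "cmod (w x) * cmod (h x) \<le> B * (indicator E x / m)"
          by (intro mult_mono hb) (use order_trans[OF norm_ge_zero] in auto)
        then show ?case by (simp add: norm_mult)
      qed
    qed (use ind L2_inner_integrable[OF w h] in auto)
    finally show "cmod (L2_inner M w h) \<le> B" using ind by simp
  qed
qed

lemma (in finite_measure) L2_norm_le_of_Lp:
  assumes u: "u \<in> Lp_space p M" "2 \<le> p" "(\<integral>x. cmod (u x) powr p \<partial>M) \<le> 1"
  shows "L2_norm M u \<le> sqrt (measure M (space M) + 1)"
proof -
  have "(\<integral>x. (cmod (u x))\<^sup>2 \<partial>M) \<le> (\<integral>x. 1 + cmod (u x) powr p \<partial>M)"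
  proof (rule integral_mono)
    show "integrable M (\<lambda>x. (cmod (u x))\<^sup>2)"
      using L2_integrable[OF Lp_mono[OF u(1) _ u(2)]] by simp
    show "integrable M (\<lambda>x. 1 + cmod (u x) powr p)"
      using Lp_integrable[OF u(1)] by simp
    show "(cmod (u x))\<^sup>2 \<le> 1 + cmod (u x) powr p" for x
      using powr_le_1_add_powr[of "cmod (u x)" 2 p] u by simp
  qed
  also have "\<dots> = measure M (space M) + (\<integral>x. cmod (u x) powr p \<partial>M)"
    using Lp_integrable[OF u(1)] by simp
  finally show ?thesis unfolding L2_norm_def using u by simp
qed

text \<open>If \<open>T\<close> is unbounded on the unit ball of \<open>L\<^sub>p\<close>, there are functionals \<open>f\<^sub>j = \<langle>T \<cdot>, h\<^sub>j\<rangle>\<close>, dominated by the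
  essential supremum of \<open>T \<cdot>\<close>, of norm at least \<open>12\<^sup>j\<close> on \<open>L\<^sub>p\<close>, and almost norming \<open>u\<^sub>j\<close> in the ball. With suitable signs
  \<open>V = \<Sum>\<^sub>i \<plusminus>3\<^sup>-\<^sup>i u\<^sub>i\<close> satisfies \<open>|f\<^sub>j(V)| \<ge> 4\<^sup>j/4\<close> for all \<open>j\<close>, so that \<open>T V\<close> is unbounded.\<close>

lemma (in finite_measure) Lp_operator_bounded_on_ball:
  assumes T: "L2_bounded_operator M T" and p: "2 \<le> p"
    and ess: "\<And>u. u \<in> Lp_space p M \<Longrightarrow> \<exists>B. AE x in M. cmod (T u x) \<le> B"
  obtains A where "\<And>u. u \<in> Lp_space p M \<Longrightarrow> (\<integral>x. cmod (u x) powr p \<partial>M) \<le> 1 \<Longrightarrow> AE x in M. cmod (T u x) \<le> A"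
proof (rule ccontr)
  note T' = L2_bounded_operatorD[OF T]
  let ?L = "Lp_space 2 M"
  define U where "U = {u \<in> Lp_space p M. (\<integral>x. cmod (u x) powr p \<partial>M) \<le> 1}"
  have UL: "u \<in> ?L" if "u \<in> U" for u using that p Lp_mono[of u p 2] by (auto simp: U_def)
  obtain C where C: "0 \<le> C" "\<And>u. u \<in> ?L \<Longrightarrow> L2_norm M (T u) \<le> C * L2_norm M u"
    using L2_bounded_operator_bound[OF T] by blast
  assume "\<not> thesis"
  then have neg: "\<exists>u\<in>U. \<not> (AE x in M. cmod (T u x) \<le> A)" for A
    using that[of A] by (auto simp: U_def)
  have "\<exists>h u N. h \<in> ?L \<and> u \<in> U \<and> A \<le> N \<and> (\<forall>w\<in>U. cmod (L2_inner M (T w) h) \<le> N)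
      \<and> 3/4 * N \<le> cmod (L2_inner M (T u) h)
      \<and> (\<forall>w\<in>?L. \<forall>B. (AE x in M. cmod (T w x) \<le> B) \<longrightarrow> cmod (L2_inner M (T w) h) \<le> B)"
    if A: "0 < A" for A
  proof -
    obtain u where u: "u \<in> U" "\<not> (AE x in M. cmod (T u x) \<le> A)" using neg by blast
    obtain h where h: "h \<in> ?L" "A \<le> cmod (L2_inner M (T u) h)"
        "\<And>w B. w \<in> ?L \<Longrightarrow> AE x in M. cmod (w x) \<le> B \<Longrightarrow> cmod (L2_inner M w h) \<le> B"
      using essential_bound_test[OF T'(1)[OF UL[OF u(1)]] u(2)] by blast
    define f where "f w = cmod (L2_inner M (T w) h)" for w
    have "f w \<le> C * sqrt (measure M (space M) + 1) * L2_norm M h" if w: "w \<in> U" for w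
    proof -
      have "f w \<le> L2_norm M (T w) * L2_norm M h"
        unfolding f_def by (intro L2_Cauchy_Schwarz T' UL w h)
      also have "\<dots> \<le> C * L2_norm M w * L2_norm M h"
        by (intro mult_right_mono C UL w) simp
      also have "\<dots> \<le> C * sqrt (measure M (space M) + 1) * L2_norm M h"
        using w p by (intro mult_right_mono mult_left_mono L2_norm_le_of_Lp C) (auto simp: U_def)
      finally show ?thesis .
    qed
    then have bdd: "bdd_above (f ` U)" by (intro bdd_aboveI2)
    \<comment> \<open>The supremum is finite since \<open>h\<close> lies in L_2 and \<open>T\<close>
      is bounded on L_2; it need not be bounded uniformly in \<open>h\<close>.\<close>
    define N where "N = Sup (f ` U)"
    have fN: "f w \<le> N" if "w \<in> U" for w unfolding N_def using that bdd by (intro cSUP_upper)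
    have AN: "A \<le> N" using h(2) fN[OF u(1)] by (simp add: f_def)
    have "3/4 * N < Sup (f ` U)" using A AN by (simp flip: N_def)
    then obtain v where "v \<in> U" "3/4 * N < f v"
      using less_cSUP_iff[OF _ bdd] u by blast
    then show ?thesis using h AN fN T'(1) unfolding f_def
      by (intro exI[of _ h] exI[of _ v] exI[of _ N]) auto
  qed
  \<comment> \<open>The growth 12^j leaves 4^j after multiplication by the coefficient 3^-j.\<close>
  then have "\<exists>h u N. h \<in> ?L \<and> u \<in> U \<and> 12 ^ j \<le> N \<and> (\<forall>w\<in>U. cmod (L2_inner M (T w) h) \<le> N)
      \<and> 3/4 * N \<le> cmod (L2_inner M (T u) h)
      \<and> (\<forall>w\<in>?L. \<forall>B. (AE x in M. cmod (T w x) \<le> B) \<longrightarrow> cmod (L2_inner M (T w) h) \<le> B)" for j :: nat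
    by simp
  then obtain h u N where h: "\<And>j. h j \<in> ?L" and u: "\<And>j. u j \<in> U" and N: "\<And>j::nat. 12 ^ j \<le> N j"
    and le: "\<And>j w. w \<in> U \<Longrightarrow> cmod (L2_inner M (T w) (h j)) \<le> N j"
    and diag: "\<And>j. 3/4 * N j \<le> cmod (L2_inner M (T (u j)) (h j))"
    and hB: "\<And>j w B. w \<in> ?L \<Longrightarrow> AE x in M. cmod (T w x) \<le> B \<Longrightarrow> cmod (L2_inner M (T w) (h j)) \<le> B"
    by metis
  obtain c where c: "\<And>i. cmod (c i) \<le> (1/3) ^ i"
    and cs: "\<And>j n. j < n \<Longrightarrow> (1/3) ^ j * N j / 4 \<le> cmod (\<Sum>i<n. c i * L2_inner M (T (u i)) (h j))"
    using gliding_hump_signs[of "\<lambda>j i. L2_inner M (T (u i)) (h j)" N, OF le[OF u] diag] by blast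
  have uL: "u i \<in> ?L" for i by (rule UL[OF u])
  have up: "u i \<in> Lp_space p M" "(\<integral>x. cmod (u i x) powr p \<partial>M) \<le> 1" for i
    using u[of i] by (auto simp: U_def)
  define V where "V x = (\<Sum>i. c i * u i x)" for x
  define W where "W n x = (\<Sum>i<n. c i * u i x)" for n x
  have V: "V \<in> Lp_space p M" and lim: "(\<lambda>n. L2_norm M (\<lambda>x. W n x - V x)) \<longlonglongrightarrow> 0"
    using L2_series[OF p up c] by (simp_all add: V_def[abs_def] W_def[abs_def])
  have VL: "V \<in> ?L" using p by (intro Lp_mono[OF V]) auto
  have WL: "W n \<in> ?L" for n unfolding W_def by (intro Lp_sum Lp_scale uL) simp
  have dL: "(\<lambda>x. W n x - V x) \<in> ?L" for n by (intro Lp_diff WL VL) simp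
  have TW: "L2_inner M (T (W n)) (h j) = (\<Sum>i<n. c i * L2_inner M (T (u i)) (h j))" for n j
  proof (induction n)
    case 0
    have "L2_inner M (T (\<lambda>x. 0 * V x)) (h j) = 0 * L2_inner M (T V) (h j)"
      by (intro L2_inner_operator_scale T VL h)
    then show ?case by (simp add: W_def [abs_def])
  next
    case (Suc n)
    have "W (Suc n) = (\<lambda>x. W n x + c n * u n x)" by (simp add: W_def fun_eq_iff)
    then show ?case using Suc
      by (simp add: L2_inner_operator_add[OF T WL Lp_scale[OF uL] h] L2_inner_operator_scale[OF T uL h])
  qed
  have limT: "(\<lambda>n. L2_norm M (\<lambda>x. T (W n) x - T V x)) \<longlonglongrightarrow> 0"
  proof (rule Lim_null_comparison)
    show "\<forall>\<^sub>F n in sequentially. norm (L2_norm M (\<lambda>x. T (W n) x - T V x)) \<le> C * L2_norm M (\<lambda>x. W n x - V x)"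
    proof (intro always_eventually allI)
      fix n
      have "L2_norm M (\<lambda>x. T (W n) x - T V x) = L2_norm M (T (\<lambda>x. W n x - V x))"
        using L2_bounded_operator_diff[OF T WL VL, of n]
          T'(1)[OF WL, THEN Lp_measurable] T'(1)[OF VL, THEN Lp_measurable] T'(1)[OF dL, THEN Lp_measurable]
        by (intro L2_norm_cong) (auto elim: eventually_mono)
      then show "norm (L2_norm M (\<lambda>x. T (W n) x - T V x)) \<le> C * L2_norm M (\<lambda>x. W n x - V x)"
        using C(2)[OF dL] by simp
    qed
    show "(\<lambda>n. C * L2_norm M (\<lambda>x. W n x - V x)) \<longlonglongrightarrow> 0"
      using tendsto_mult_left[OF lim, of C] by simp
  qed
  obtain B where B: "AE x in M. cmod (T V x) \<le> B" using ess[OF V] by blast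
  have "4 ^ j / 4 \<le> B" for j :: nat
  proof -
    have "(\<lambda>n. cmod (L2_inner M (T (W n)) (h j))) \<longlonglongrightarrow> cmod (L2_inner M (T V) (h j))"
      by (intro tendsto_norm L2_inner_tendsto_left limT T' WL VL h)
    moreover have "\<exists>n0. \<forall>n\<ge>n0. (1/3) ^ j * N j / 4 \<le> cmod (L2_inner M (T (W n)) (h j))"
      unfolding TW using cs[of j] by (intro exI[of _ "Suc j"]) auto
    ultimately have "(1/3) ^ j * N j / 4 \<le> cmod (L2_inner M (T V) (h j))"
      by (rule LIMSEQ_le_const)
    also have "\<dots> \<le> B" by (rule hB[OF VL B])
    finally have "(1/3) ^ j * N j / 4 \<le> B" .
    moreover have "(1/3) ^ j * 12 ^ j \<le> (1/3) ^ j * N j" using N[of j] by (intro mult_left_mono) auto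
    moreover have "(1/3) ^ j * 12 ^ j = (4::real) ^ j" by (simp flip: power_mult_distrib)
    ultimately show ?thesis by linarith
  qed
  moreover obtain j :: nat where "4 * B < 4 ^ j" using real_arch_pow[of 4 "4 * B"] by auto
  ultimately show False by (metis leD mult.commute pos_divide_le_eq zero_less_numeral)
qed

lemma (in finite_measure) Lp_operator_bounded:
  assumes T: "L2_bounded_operator M T" and p: "2 \<le> p"
    and ess: "\<And>u. u \<in> Lp_space p M \<Longrightarrow> \<exists>B. AE x in M. cmod (T u x) \<le> B"
  obtains A where "0 \<le> A"
    "\<And>u. u \<in> Lp_space p M \<Longrightarrow> AE x in M. cmod (T u x) \<le> A * (\<integral>x. cmod (u x) powr p \<partial>M) powr (1/p)"
proof -
  note T' = L2_bounded_operatorD[OF T]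
  obtain A where A: "\<And>u. u \<in> Lp_space p M \<Longrightarrow> (\<integral>x. cmod (u x) powr p \<partial>M) \<le> 1 \<Longrightarrow> AE x in M. cmod (T u x) \<le> A"
    using Lp_operator_bounded_on_ball[OF T p ess] by blast
  show thesis
  proof (rule that[of "\<bar>A\<bar>"])
    fix u assume u: "u \<in> Lp_space p M"
    then have uL: "u \<in> Lp_space 2 M" using p by (intro Lp_mono[OF u]) auto
    define I where "I = (\<integral>x. cmod (u x) powr p \<partial>M)"
    have I0: "0 \<le> I" by (simp add: I_def)
    show "AE x in M. cmod (T u x) \<le> \<bar>A\<bar> * (\<integral>x. cmod (u x) powr p \<partial>M) powr (1/p)"
    proof (cases "I = 0")
      case True
      then have "AE x in M. cmod (u x) powr p = 0"
        unfolding I_def using integral_nonneg_eq_0_iff_AE[OF Lp_integrable[OF u]] by simp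
      then have "AE x in M. u x = 0 * u x" by eventually_elim simp
      then have "AE x in M. T u x = T (\<lambda>x. 0 * u x) x"
        by (intro T' uL Lp_scale)
      moreover have "AE x in M. T (\<lambda>x. 0 * u x) x = 0 * T u x" by (rule T'(4)[OF uL])
      ultimately show ?thesis by eventually_elim simp
    next
      case False
      define c where "c = I powr (- (1/p))"
      have c: "0 < c" using False I0 by (simp add: c_def)
      have "(\<integral>x. cmod (of_real c * u x) powr p \<partial>M) = c powr p * I"
        using c by (simp add: norm_mult powr_mult I_def)
      also have "c powr p = I powr (- (1/p) * p)" by (simp only: c_def powr_powr)
      also have "\<dots> = 1 / I" using p I0 by (simp add: powr_minus_divide)
      also have "1 / I * I = 1" using False by simp
      finally have "AE x in M. cmod (T (\<lambda>x. of_real c * u x) x) \<le> A"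
        using A[OF Lp_scale[OF u, of "of_real c"]] by simp
      moreover have "AE x in M. T (\<lambda>x. of_real c * u x) x = of_real c * T u x"
        by (rule T'(4)[OF uL])
      ultimately show ?thesis
      proof eventually_elim
        case (elim x)
        then have "c * cmod (T u x) \<le> \<bar>A\<bar>" using c by (simp add: norm_mult)
        then have "cmod (T u x) \<le> \<bar>A\<bar> / c" using c by (simp add: field_simps)
        also have "\<bar>A\<bar> / c = \<bar>A\<bar> * I powr (1/p)"
          by (simp add: c_def powr_minus divide_inverse)
        finally show ?case by (simp add: I_def)
      qed
    qed
  qed simp
qed

section \<open>Gain of integrability\<close>

text \<open>A symmetric relation, in contrast to \<open>L2_adjoint\<close>, whose values are chosen
  only up to null sets and whose iteration need not return \<open>T\<close> literally. Lemmas about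
  the pair of \<open>S\<close> and \<open>S'\<close> can so be reused with the roles
  exchanged.\<close>

definition L2_adjoint_pair ::
  "'a measure \<Rightarrow> (('a \<Rightarrow> complex) \<Rightarrow> 'a \<Rightarrow> complex) \<Rightarrow> (('a \<Rightarrow> complex) \<Rightarrow> 'a \<Rightarrow> complex) \<Rightarrow> bool" where
  "L2_adjoint_pair M T T' \<longleftrightarrow> L2_bounded_operator M T \<and> L2_bounded_operator M T' \<and>
     (\<forall>u\<in>Lp_space 2 M. \<forall>v\<in>Lp_space 2 M. L2_inner M (T u) v = L2_inner M u (T' v))"

lemma L2_adjoint_pairD:
  assumes "L2_adjoint_pair M T T'"
  shows "L2_bounded_operator M T" "L2_bounded_operator M T'"
    "\<And>u v. u \<in> Lp_space 2 M \<Longrightarrow> v \<in> Lp_space 2 M \<Longrightarrow> L2_inner M (T u) v = L2_inner M u (T' v)"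
  using assms by (auto simp: L2_adjoint_pair_def)

lemma L2_adjoint_pair_sym:
  assumes "L2_adjoint_pair M T T'"
  shows "L2_adjoint_pair M T' T"
  unfolding L2_adjoint_pair_def
  using L2_adjoint_pairD[OF assms] L2_inner_cnj by metis

lemma (in finite_measure) L2_adjoint_pair_adjoint:
  assumes "L2_bounded_operator M T"
  shows "L2_adjoint_pair M T (L2_adjoint M T)"
  using assms L2_adjoint[OF assms] by (auto simp: L2_adjoint_pair_def)

text \<open>A layer-cake sum over the levels s b^n: up to the factor s^q, f^q is bounded by 1 plus
  the sum of b^(q (n + 1)) over the levels exceeded, and the condition on \<open>\<rho>\<close>
  makes the measures of the level sets summable against these weights.\<close>

lemma (in finite_measure) integrable_powr_of_measure_decay:
  fixes f :: "'a \<Rightarrow> real"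
  assumes [measurable]: "f \<in> borel_measurable M" and f0: "\<And>x. 0 \<le> f x"
    and s: "0 < s" and b: "1 < b" and q: "0 \<le> q" and \<rho>: "0 \<le> \<rho>" "\<rho> * b powr q < 1"
    and decay: "\<And>n. measure M {x \<in> space M. s * b ^ n < f x} \<le> C * \<rho> ^ n"
  shows "integrable M (\<lambda>x. f x powr q)"
proof -
  define E where "E n = {x \<in> space M. s * b ^ n < f x}" for n
  have [measurable]: "E n \<in> sets M" for n by (simp add: E_def)
  \<comment> \<open>The exponent is \<open>Suc n\<close> because a point above level n but not above
    the next one is bounded only by level n + 1.\<close>
  define c where "c n = (b powr q) ^ Suc n" for n
  define F where "F x = 1 + (\<Sum>n. ennreal (c n) * indicator (E n) x)" for x
  have [measurable]: "F \<in> borel_measurable M" by (simp add: F_def [abs_def])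
  have c0: "0 \<le> c n" for n by (simp add: c_def)
  have C0: "0 \<le> C" using decay[of 0] measure_nonneg by (metis mult.right_neutral order_trans power_0)
  have "(\<integral>\<^sup>+x. F x \<partial>M) = emeasure M (space M) + (\<Sum>n. ennreal (c n) * emeasure M (E n))"
    unfolding F_def
    by (subst nn_integral_add) (auto simp: nn_integral_suminf nn_integral_cmult_indicator)
  also have "(\<Sum>n. ennreal (c n) * emeasure M (E n)) \<le> (\<Sum>n. ennreal (C * b powr q * (\<rho> * b powr q) ^ n))"
  proof (intro suminf_le summableI)
    fix n
    have "ennreal (c n) * emeasure M (E n) = ennreal (c n * measure M (E n))"
      using c0 by (simp add: emeasure_eq_measure ennreal_mult)
    also have "c n * measure M (E n) \<le> c n * (C * \<rho> ^ n)"
      unfolding E_def by (intro mult_left_mono decay c0)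
    also have "\<dots> = C * b powr q * (\<rho> * b powr q) ^ n"
      by (simp add: c_def power_mult_distrib mult_ac)
    finally show "ennreal (c n) * emeasure M (E n) \<le> ennreal (C * b powr q * (\<rho> * b powr q) ^ n)"
      by (simp add: ennreal_leI)
  qed
  also have "\<dots> = ennreal (\<Sum>n. C * b powr q * (\<rho> * b powr q) ^ n)"
    using C0 \<rho> by (intro suminf_ennreal_eq summable_sums) (auto intro!: summable_mult)
  also have "emeasure M (space M) + \<dots> < \<infinity>" by (simp add: emeasure_eq_measure)
  finally have Ffin: "(\<integral>\<^sup>+x. F x \<partial>M) < \<infinity>" by (simp add: add_left_mono)
  have key: "ennreal (f x powr q) \<le> ennreal (s powr q) * F x" if x: "x \<in> space M" for x
  proof (cases "f x \<le> s")
    case True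
    then have "ennreal (f x powr q) \<le> ennreal (s powr q) * 1"
      using f0 q by (auto intro!: ennreal_leI powr_mono2)
    also have "\<dots> \<le> ennreal (s powr q) * F x"
      by (intro mult_left_mono) (auto simp: F_def)
    finally show ?thesis .
  next
    case False
    define N where "N = (LEAST n. f x \<le> s * b ^ n)"
    obtain n0 where "f x / s < b ^ n0" using real_arch_pow[OF b] by blast
    then have ex: "f x \<le> s * b ^ n0" using s by (simp add: field_simps)
    have N: "f x \<le> s * b ^ N" unfolding N_def by (rule LeastI[of _ n0]) (rule ex)
    then have "N \<noteq> 0" using False by (cases N) auto
    then obtain n where n: "N = Suc n" using not0_implies_Suc by blast
    have "\<not> f x \<le> s * b ^ n"
      using not_less_Least[of n "\<lambda>n. f x \<le> s * b ^ n"] n by (simp add: N_def)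
    then have xE: "x \<in> E n" using x by (simp add: E_def)
    have "f x powr q \<le> (s * b ^ Suc n) powr q"
      using N f0 q unfolding n by (intro powr_mono2) auto
    also have "\<dots> = s powr q * c n"
      using s b by (simp add: powr_mult c_def powr_power powr_realpow[symmetric] powr_powr mult_ac)
    finally have "ennreal (f x powr q) \<le> ennreal (s powr q) * ennreal (c n)"
      using c0 by (simp flip: ennreal_mult)
    also have "ennreal (c n) \<le> (\<Sum>n. ennreal (c n) * indicator (E n) x)"
      using sum_le_suminf[of "\<lambda>n. ennreal (c n) * indicator (E n) x" "{n}"] xE by simp
    also have "\<dots> \<le> F x" by (simp add: F_def)
    finally show ?thesis by (simp add: mult_left_mono)
  qed
  show ?thesis
  proof (rule integrableI_nonneg)
    have "(\<integral>\<^sup>+x. ennreal (f x powr q) \<partial>M) \<le> (\<integral>\<^sup>+x. ennreal (s powr q) * F x \<partial>M)"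
      by (intro nn_integral_mono key)
    also have "\<dots> = ennreal (s powr q) * (\<integral>\<^sup>+x. F x \<partial>M)"
      by (rule nn_integral_cmult) simp
    also have "\<dots> < \<infinity>" using Ffin by (simp add: ennreal_mult_less_top)
    finally show "(\<integral>\<^sup>+x. ennreal (f x powr q) \<partial>M) < \<infinity>" .
  qed auto
qed

text \<open>Truncate \<open>u\<close> at height \<open>l\<close>. The bounded part is controlled by the estimate
  from \<open>L\<^sub>r\<close> to \<open>L\<^sub>\<infinity>\<close> for \<open>T\<close>; the remainder is small in \<open>L\<^sub>1\<close>, and it is
  controlled by duality and the estimate for \<open>T'\<close>, applied to a unimodular function on the set
  where \<open>T u\<close> is large.\<close>

lemma (in finite_measure) adjoint_pair_weak_estimate:
  assumes TT: "L2_adjoint_pair M T T'" and p: "2 \<le> p" "p < r" and A: "0 < A"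
    and TA: "\<And>u. u \<in> Lp_space r M \<Longrightarrow> AE x in M. cmod (T u x) \<le> A * (\<integral>x. cmod (u x) powr r \<partial>M) powr (1/r)"
    and TA': "\<And>u. u \<in> Lp_space r M \<Longrightarrow> AE x in M. cmod (T' u x) \<le> A * (\<integral>x. cmod (u x) powr r \<partial>M) powr (1/r)"
    and u: "u \<in> Lp_space p M"
  obtains s C where "0 < s"
    "\<And>l. 0 < l \<Longrightarrow> measure M {x \<in> space M. s * l powr (1 - p/r) < cmod (T u x)} \<le> C * l powr (- p)"
proof -
  note tt = L2_adjoint_pairD[OF TT]
  note T = L2_bounded_operatorD[OF tt(1)]
  note T' = L2_bounded_operatorD[OF tt(2)]
  have [measurable]: "u \<in> borel_measurable M" using u by (simp add: Lp_space_def)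
  have uL: "u \<in> Lp_space 2 M" using p by (intro Lp_mono[OF u]) auto
  have [measurable]: "T u \<in> borel_measurable M" using T(1)[OF uL] by (simp add: Lp_space_def)
  define I where "I = (\<integral>x. cmod (u x) powr p \<partial>M)"
  have I0: "0 \<le> I" by (simp add: I_def)
  have ui: "integrable M (\<lambda>x. cmod (u x) powr p)" by (rule Lp_integrable[OF u])
  \<comment> \<open>\<open>I + 1\<close> instead of \<open>I\<close> keeps \<open>J\<close> positive
    for a null \<open>u\<close>; \<open>C\<close> results from solving the inequality
    \<open>main\<close> below for the measure \<open>m\<close>.\<close>
  define J where "J = (I + 1) powr (1/r)"
  have J0: "0 < J" using I0 by (simp add: J_def)
  define C where "C = (I / J) powr (1 / (1 - 1/r))"
  show thesis
  proof (rule that[of "2 * (A * J)" C])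
    show "0 < 2 * (A * J)" using A J0 by simp
    fix l :: real assume l: "0 < l"
    \<comment> \<open>An essential bound for \<open>T g\<close>, since the integral of |g|^r is at
      most l^(r - p) times that of |u|^p.\<close>
    define s where "s = A * J * l powr (1 - p/r)"
    have s0: "0 < s" using A J0 l by (simp add: s_def)
    define g where "g x = (if cmod (u x) \<le> l then u x else 0)" for x
    define w where "w x = u x - g x" for x
    have [measurable]: "g \<in> borel_measurable M" by (simp add: g_def [abs_def])
    have gb: "cmod (g x) \<le> l" for x using l by (simp add: g_def)
    have gr: "g \<in> Lp_space r M" and gL: "g \<in> Lp_space 2 M" using gb p by (auto intro!: Lp_bounded[of _ l])
    have wL: "w \<in> Lp_space 2 M" unfolding w_def by (intro Lp_diff uL gL) simp
    have [measurable]: "T w \<in> borel_measurable M" using T(1)[OF wL] by (simp add: Lp_space_def)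
    have "(\<integral>x. cmod (g x) powr r \<partial>M) \<le> (\<integral>x. l powr (r - p) * cmod (u x) powr p \<partial>M)"
    proof (rule integral_mono[OF Lp_integrable[OF gr]])
      show "integrable M (\<lambda>x. l powr (r - p) * cmod (u x) powr p)" using ui by simp
      show "cmod (g x) powr r \<le> l powr (r - p) * cmod (u x) powr p" for x
      proof (cases "cmod (u x) \<le> l")
        case True
        have "cmod (u x) powr r = cmod (u x) powr (r - p) * cmod (u x) powr p"
          by (simp flip: powr_add)
        also have "\<dots> \<le> l powr (r - p) * cmod (u x) powr p"
          using True p by (intro mult_right_mono powr_mono2) auto
        finally show ?thesis using True by (simp add: g_def)
      qed (simp add: g_def)
    qed
    also have "\<dots> \<le> l powr (r - p) * (I + 1)" by (simp add: I_def distrib_left)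
    finally have "(\<integral>x. cmod (g x) powr r \<partial>M) powr (1/r) \<le> (l powr (r - p) * (I + 1)) powr (1/r)"
      using p by (intro powr_mono2) auto
    also have "\<dots> = l powr ((r - p) * (1/r)) * J"
      using I0 by (simp only: powr_mult powr_powr J_def)
    also have "(r - p) * (1/r) = 1 - p/r" using p by (simp add: field_simps)
    finally have "A * (\<integral>x. cmod (g x) powr r \<partial>M) powr (1/r) \<le> s"
      using A by (simp add: s_def mult_ac)
    then have Tg: "AE x in M. cmod (T g x) \<le> s"
      using TA[OF gr] by (auto elim: eventually_mono)
    \<comment> \<open>Where \<open>w\<close> is nonzero, |u| > l; as 1 - p < 0, the L_1 norm of
      \<open>w\<close> decays like l^(1 - p).\<close>
    have wb: "cmod (w x) \<le> l powr (1 - p) * cmod (u x) powr p" for x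
    proof (cases "cmod (u x) \<le> l")
      case False
      then have u0: "0 < cmod (u x)" using l by linarith
      have "cmod (u x) = cmod (u x) powr (1 - p) * cmod (u x) powr p"
        using u0 by (simp flip: powr_add)
      also have "\<dots> \<le> l powr (1 - p) * cmod (u x) powr p"
        using False l p by (intro mult_right_mono powr_mono2') auto
      finally show ?thesis using False by (simp add: w_def g_def)
    qed (simp add: w_def g_def)
    \<comment> \<open>One half of the level \<open>2 * s\<close> is absorbed by \<open>T g\<close>,
      so that |T w| exceeds \<open>s\<close> almost everywhere on \<open>E\<close>.\<close>
    define E where "E = {x \<in> space M. 2 * s < cmod (T u x)}"
    have [measurable]: "E \<in> sets M" by (simp add: E_def)
    define m where "m = measure M E"
    have m0: "0 \<le> m" by (simp add: m_def)
    define h where "h x = indicator E x *\<^sub>R sgn (T w x)" for x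
    have hm [measurable]: "h \<in> borel_measurable M" by (simp add: h_def [abs_def])
    have hb: "cmod (h x) \<le> indicator E x" for x by (simp add: h_def norm_sgn indicator_def)
    have "cmod (h x) \<le> 1" for x by (rule order_trans[OF hb]) (simp add: indicator_def)
    then have hL: "h \<in> Lp_space 2 M" and hr: "h \<in> Lp_space r M" using p by (auto intro!: Lp_bounded[of _ 1])
    have Ei: "integrable M (\<lambda>x. indicator E x :: real)" by (simp add: emeasure_eq_measure)
    have "(\<integral>x. cmod (h x) powr r \<partial>M) \<le> (\<integral>x. indicator E x \<partial>M)"
    proof (rule integral_mono[OF Lp_integrable[OF hr] Ei])
      show "cmod (h x) powr r \<le> indicator E x" for x
        using hb[of x] p powr_mono2[of r "cmod (h x)" 1] by (cases "x \<in> E") auto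
    qed
    then have "A * (\<integral>x. cmod (h x) powr r \<partial>M) powr (1/r) \<le> A * m powr (1/r)"
      using A p by (intro mult_left_mono powr_mono2) (auto simp: m_def)
    then have T'h: "AE x in M. cmod (T' h x) \<le> A * m powr (1/r)"
      using TA'[OF hr] by (auto elim: eventually_mono)
    have Tw: "AE x in M. T w x = T u x - T g x"
      unfolding w_def by (rule L2_bounded_operator_diff[OF tt(1) uL gL])
    have wh: "T w x * cnj (h x) = of_real (indicator E x * cmod (T w x))" for x
    proof -
      have "T w x * cnj (sgn (T w x)) = of_real (cmod (T w x))"
        by (cases "T w x = 0")
          (simp_all add: sgn_eq complex_norm_square[symmetric] power2_eq_square)
      then show ?thesis by (simp add: h_def scaleR_conv_of_real mult.left_commute mult.commute)
    qed
    have "s * m = (\<integral>x. s * indicator E x \<partial>M)" by (simp add: m_def)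
    also have "\<dots> \<le> (\<integral>x. indicator E x * cmod (T w x) \<partial>M)"
    proof (rule integral_mono_AE)
      show "integrable M (\<lambda>x. s * indicator E x)" using Ei by simp
      have "integrable M (\<lambda>x. complex_of_real (indicator E x * cmod (T w x)))"
        using L2_inner_integrable[OF T(1)[OF wL] hL] by (simp only: wh)
      then show "integrable M (\<lambda>x. indicator E x * cmod (T w x))"
        by (simp only: complex_of_real_integrable_eq)
      show "AE x in M. s * indicator E x \<le> indicator E x * cmod (T w x)"
        using Tg Tw
      proof eventually_elim
        case (elim x)
        show ?case
        proof (cases "x \<in> E")
          case True
          then have "2 * s < cmod (T u x)" by (simp add: E_def)
          moreover have "cmod (T u x) \<le> cmod (T w x) + cmod (T g x)"
            using norm_triangle_ineq[of "T w x" "T g x"] elim(2) by simp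
          ultimately show ?thesis using True elim(1) by simp
        qed simp
      qed
    qed
    also have "\<dots> = Re (L2_inner M (T w) h)"
      unfolding L2_inner_def wh by (simp only: integral_complex_of_real Re_complex_of_real)
    also have "\<dots> \<le> cmod (L2_inner M (T w) h)" by (rule complex_Re_le_cmod)
    also have "L2_inner M (T w) h = L2_inner M w (T' h)" by (rule tt(3)[OF wL hL])
    also have "cmod \<dots> \<le> (\<integral>x. cmod (w x * cnj (T' h x)) \<partial>M)"
      unfolding L2_inner_def by (rule integral_norm_bound)
    also have "\<dots> \<le> (\<integral>x. l powr (1 - p) * cmod (u x) powr p * (A * m powr (1/r)) \<partial>M)"
    proof (rule integral_mono_AE)
      show "integrable M (\<lambda>x. cmod (w x * cnj (T' h x)))"
        using L2_inner_integrable[OF wL T'(1)[OF hL]] by simp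
      show "integrable M (\<lambda>x. l powr (1 - p) * cmod (u x) powr p * (A * m powr (1/r)))" using ui by simp
      show "AE x in M. cmod (w x * cnj (T' h x)) \<le> l powr (1 - p) * cmod (u x) powr p * (A * m powr (1/r))"
        using T'h by eventually_elim (unfold norm_mult complex_mod_cnj, intro mult_mono wb, auto)
    qed
    also have "\<dots> = l powr (1 - p) * I * (A * m powr (1/r))" by (simp add: I_def)
    finally have main: "s * m \<le> l powr (1 - p) * I * (A * m powr (1/r))" .
    have "m \<le> C * l powr (- p)"
    proof (cases "m = 0")
      case False
      then have mp: "0 < m" using m0 by simp
      \<comment> \<open>Splitting \<open>m\<close> as \<open>m powr k * m powr (1/r)\<close> permits
        cancelling the factor \<open>m powr (1/r)\<close> that the duality estimate leaves on the
        right; this uses that \<open>m\<close> is positive.\<close>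
      define k where "k = 1 - 1/r"
      have k: "0 < k" using p by (simp add: k_def field_simps)
      have "m = m powr k * m powr (1/r)" using mp by (simp add: k_def flip: powr_add)
      then have "(s * m powr k) * m powr (1/r) \<le> (l powr (1 - p) * I * A) * m powr (1/r)"
        using main by (simp add: mult_ac)
      then have "s * m powr k \<le> l powr (1 - p) * I * A" using mp by simp
      then have "(A * J * l powr (1 - p/r)) * m powr k \<le> (A * J * l powr (1 - p/r)) * (I / J * l powr (- p * k))"
      proof -
        have "l powr (1 - p/r) * l powr (- p * k) = l powr (1 - p)"
          using p by (simp add: k_def right_diff_distrib flip: powr_add)
        then have "(A * J * l powr (1 - p/r)) * (I / J * l powr (- p * k)) = l powr (1 - p) * I * A"
          using J0 by (simp add: mult_ac)
        then show ?thesis using \<open>s * m powr k \<le> _\<close> unfolding s_def by linarith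
      qed
      then have "m powr k \<le> I / J * l powr (- p * k)" using s0 unfolding s_def[symmetric]
        by (rule mult_left_le_imp_le)
      then have "(m powr k) powr (1/k) \<le> (I / J * l powr (- p * k)) powr (1/k)"
        using k by (intro powr_mono2) auto
      also have "\<dots> = (I / J) powr (1/k) * l powr (- p * k * (1/k))"
        using I0 J0 by (simp only: powr_mult powr_powr)
      also have "- p * k * (1/k) = - p" using k by simp
      finally show ?thesis using k mp by (simp add: powr_powr C_def flip: k_def)
    qed (simp add: C_def)
    then show "measure M {x \<in> space M. 2 * (A * J) * l powr (1 - p/r) < cmod (T u x)} \<le> C * l powr (- p)"
      by (simp add: m_def E_def s_def mult.assoc)
  qed
qed

text \<open>For l = 2^n the weak estimate has levels s 2^(\<alpha> n) and measures at most C 2^(-p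
  n) with \<alpha> = 1 - p/r, so every exponent below p/\<alpha> is within reach. The increment 1/r
  is not optimal, but it is independent of \<open>p\<close> and stays below this threshold for all p
  \<ge> 2.\<close>

lemma (in finite_measure) adjoint_pair_gain:
  assumes TT: "L2_adjoint_pair M T T'" and p: "2 \<le> p" "p < r" and A: "0 < A"
    and TA: "\<And>u. u \<in> Lp_space r M \<Longrightarrow> AE x in M. cmod (T u x) \<le> A * (\<integral>x. cmod (u x) powr r \<partial>M) powr (1/r)"
    and TA': "\<And>u. u \<in> Lp_space r M \<Longrightarrow> AE x in M. cmod (T' u x) \<le> A * (\<integral>x. cmod (u x) powr r \<partial>M) powr (1/r)"
    and u: "u \<in> Lp_space p M"
  shows "T u \<in> Lp_space (p + 1/r) M"
proof -
  have uL: "u \<in> Lp_space 2 M" using p by (intro Lp_mono[OF u]) auto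
  have [measurable]: "T u \<in> borel_measurable M"
    using L2_bounded_operatorD(1)[OF L2_adjoint_pairD(1)[OF TT] uL] by (simp add: Lp_space_def)
  obtain s C where s: "0 < s"
    and dec: "\<And>l. 0 < l \<Longrightarrow> measure M {x \<in> space M. s * l powr (1 - p/r) < cmod (T u x)} \<le> C * l powr (- p)"
    using adjoint_pair_weak_estimate[OF assms] by blast
  define \<alpha> where "\<alpha> = 1 - p/r"
  have \<alpha>: "0 < \<alpha>" using p by (simp add: \<alpha>_def field_simps)
  have "\<alpha> * (p + 1/r) < p"
  proof -
    have "1 < p * p" using p mult_mono[of 2 p 2 p] by simp
    moreover have "\<alpha> * (p + 1/r) = p + (1/r) * (1 - p * p - p * (1/r))"
      by (simp add: \<alpha>_def algebra_simps)
    moreover have "0 < 1/r" "0 < p * (1/r)" using p by simp_all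
    ultimately show ?thesis using mult_pos_neg[of "1/r" "1 - p * p - p * (1/r)"] by linarith
  qed
  then have "2 powr (- p + \<alpha> * (p + 1/r)) < (2 powr 0 :: real)"
    by (subst powr_less_cancel_iff) auto
  then have ratio: "2 powr (- p) * (2 powr \<alpha>) powr (p + 1/r) < (1::real)"
    by (simp add: powr_powr flip: powr_add)
  have "integrable M (\<lambda>x. cmod (T u x) powr (p + 1/r))"
  proof (rule integrable_powr_of_measure_decay[where s=s and b="2 powr \<alpha>" and \<rho>="2 powr (- p)" and C=C])
    show "1 < 2 powr \<alpha>" using \<alpha> by (intro gr_one_powr) auto
    show "measure M {x \<in> space M. s * (2 powr \<alpha>) ^ n < cmod (T u x)} \<le> C * (2 powr (- p)) ^ n" for n
    proof -
      have e: "(2 ^ n) powr a = (2 powr a) ^ n" for a :: real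
        by (simp add: powr_power powr_powr mult.commute flip: powr_realpow)
      show ?thesis using dec[of "2 ^ n"] unfolding \<alpha>_def[symmetric] e by simp
    qed
  qed (use s p ratio in auto)
  then show ?thesis by (simp add: Lp_space_def)
qed

text \<open>Each factor of the semigroup adds \<open>1/r\<close>, whatever exponent has been reached
  before, so more than r^2 steps suffice. The operator bounds at different times are unrelated,
  which is harmless because the induction carries only membership. It runs over all
  \<open>t\<close>, since each step halves the time.\<close>

lemma (in finite_measure) semigroup_Lp_smoothing:
  assumes S: "L2_semigroup M S" and SS: "\<And>t. 0 < t \<Longrightarrow> L2_adjoint_pair M (S t) (S' t)" and r: "2 \<le> r"
    and b: "\<And>t u. 0 < t \<Longrightarrow> u \<in> Lp_space r M \<Longrightarrow> \<exists>B. AE x in M. cmod (S t u x) \<le> B"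
    and b': "\<And>t u. 0 < t \<Longrightarrow> u \<in> Lp_space r M \<Longrightarrow> \<exists>B. AE x in M. cmod (S' t u x) \<le> B"
    and t: "0 < t" and u: "u \<in> Lp_space 2 M"
  shows "S t u \<in> Lp_space r M"
proof -
  have S1: "S t u \<in> Lp_space 2 M" if "0 < t" "u \<in> Lp_space 2 M" for t u
    using L2_bounded_operatorD(1)[OF L2_adjoint_pairD(1)[OF SS]] that by blast
  have gain: "S t v \<in> Lp_space (p + 1/r) M" if p: "2 \<le> p" "p < r" and t: "0 < t" and v: "v \<in> Lp_space p M" for p t v
  proof -
    note tt = L2_adjoint_pairD[OF SS[OF t]]
    obtain A where A: "0 \<le> A" "\<And>u. u \<in> Lp_space r M \<Longrightarrow> AE x in M. cmod (S t u x) \<le> A * (\<integral>x. cmod (u x) powr r \<partial>M) powr (1/r)"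
      using Lp_operator_bounded[OF tt(1) r b[OF t]] by blast
    obtain A' where A': "0 \<le> A'" "\<And>u. u \<in> Lp_space r M \<Longrightarrow> AE x in M. cmod (S' t u x) \<le> A' * (\<integral>x. cmod (u x) powr r \<partial>M) powr (1/r)"
      using Lp_operator_bounded[OF tt(2) r b'[OF t]] by blast
    have le: "c * (\<integral>x. cmod (u x) powr r \<partial>M) powr (1/r) \<le> (A + A' + 1) * (\<integral>x. cmod (u x) powr r \<partial>M) powr (1/r)"
      if "c \<in> {A, A'}" for c and u :: "'a \<Rightarrow> complex"
      using that A(1) A'(1) by (intro mult_right_mono) auto
    show ?thesis
    proof (rule adjoint_pair_gain[OF SS[OF t] p _ _ _ v])
      show "0 < A + A' + 1" using A A' by simp
      fix u assume u: "u \<in> Lp_space r M"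
      show "AE x in M. cmod (S t u x) \<le> (A + A' + 1) * (\<integral>x. cmod (u x) powr r \<partial>M) powr (1/r)"
        using A(2)[OF u] by eventually_elim (erule order_trans, simp add: le)
      show "AE x in M. cmod (S' t u x) \<le> (A + A' + 1) * (\<integral>x. cmod (u x) powr r \<partial>M) powr (1/r)"
        using A'(2)[OF u] by eventually_elim (erule order_trans, simp add: le)
    qed
  qed
  have "S t u \<in> Lp_space (min r (2 + real n * (1/r))) M" if "0 < t" for n t
    using that
  proof (induction n arbitrary: t)
    case 0
    then show ?case using S1[OF _ u] r by simp
  next
    case (Suc n)
    define q where "q = min r (2 + real n * (1/r))"
    have q: "2 \<le> q" "q \<le> r" using r by (auto simp: q_def)
    define v where "v = S (t/2) u"
    have v: "v \<in> Lp_space q M" unfolding v_def q_def using Suc by simp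
    have vL: "v \<in> Lp_space 2 M" unfolding v_def using Suc.prems by (intro S1 u) simp
    have Sv: "S (t/2) v \<in> borel_measurable M"
      using S1[OF _ vL, of "t/2"] Suc.prems by (simp add: Lp_space_def)
    have St: "S t u \<in> borel_measurable M"
      using S1[OF _ u, of t] Suc.prems by (simp add: Lp_space_def)
    have "S (t/2) v \<in> Lp_space (min r (2 + real (Suc n) * (1/r))) M"
    proof (cases "q < r")
      case True
      have "S (t/2) v \<in> Lp_space (q + 1/r) M"
        using Suc.prems by (intro gain q True v) simp
      then show ?thesis
        by (rule Lp_mono) (use True r in \<open>auto simp: q_def min_def add_divide_distrib split: if_splits\<close>)
    next
      \<comment> \<open>At exponent \<open>r\<close> there is no further gain to use; the assumed
        essential boundedness of \<open>S (t/2) v\<close> gives membership directly.\<close>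
      case False
      then have "v \<in> Lp_space r M" using v q by simp
      then obtain B where "AE x in M. cmod (S (t/2) v x) \<le> B" using b[of "t/2" v] Suc.prems by auto
      then show ?thesis using r by (intro Lp_bounded[OF Sv]) auto
    qed
    moreover have "AE x in M. S (t/2 + t/2) u x = S (t/2) (S (t/2) u) x"
      using S Suc.prems u unfolding L2_semigroup_def by (meson half_gt_zero)
    ultimately show ?case
      using r by (intro Lp_cong[OF _ St]) (auto simp: v_def)
  qed note ind = this
  obtain n :: nat where "r * r < n" using reals_Archimedean2 by blast
  then have "r \<le> real n * (1/r)" using r by (simp add: field_simps)
  then have "min r (2 + real n * (1/r)) = r" by simp
  then show ?thesis using ind[OF t, of n] by simp
qed

section \<open>Finite Borel measures on compact metric spaces\<close>

locale compact_borel_measure = finite_measure M for M :: "'a::metric_space measure" +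
  fixes K :: "'a set"
  assumes compact_K: "compact K" and sets_M: "sets M = sets (restrict_space borel K)"
begin

lemma space_M: "space M = K"
  using sets_eq_imp_space_eq[OF sets_M] by (simp add: space_restrict_space)

lemma AE_in_K: "AE x in M. x \<in> K"
  unfolding space_M[symmetric] by (rule AE_space)

lemma continuous_measurable:
  fixes g :: "'a \<Rightarrow> 'b::topological_space"
  assumes "continuous_on K g"
  shows "g \<in> borel_measurable M"
  using borel_measurable_continuous_on_restrict[OF assms] measurable_cong_sets[OF sets_M refl, of borel] by blast

lemma continuous_bounded:
  fixes g :: "'a \<Rightarrow> complex"
  assumes "continuous_on K g"
  obtains B where "\<And>x. x \<in> K \<Longrightarrow> cmod (g x) \<le> B"
proof -
  have "bounded (g ` K)" using compact_imp_bounded compact_continuous_image[OF assms compact_K] by blast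
  then show thesis using that by (auto simp: bounded_iff)
qed

lemma continuous_Lp: "continuous_on K g \<Longrightarrow> 0 \<le> p \<Longrightarrow> g \<in> Lp_space p M"
proof -
  assume g: "continuous_on K g" and p: "0 \<le> p"
  obtain B where "\<And>x. x \<in> K \<Longrightarrow> cmod (g x) \<le> B" using continuous_bounded[OF g] by blast
  then show ?thesis using AE_in_K by (intro Lp_bounded[of _ B] continuous_measurable g p) (auto elim: eventually_mono)
qed

lemma continuous_classes_bounded:
  assumes "f \<in> continuous_classes K M"
  shows "\<exists>B. AE x in M. cmod (f x) \<le> B"
proof -
  obtain g where g: "continuous_on K g" "AE x in M. f x = g x"
    using assms by (auto simp: continuous_classes_def)
  obtain B where B: "\<And>x. x \<in> K \<Longrightarrow> cmod (g x) \<le> B" using continuous_bounded[OF g(1)] by blast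
  have "AE x in M. cmod (f x) \<le> B"
    using g(2) AE_in_K by eventually_elim (simp add: B)
  then show ?thesis by blast
qed

text \<open>Total boundedness of \<open>K\<close> provides finite nets at the scales 1/(n + 1),
  whose union is countable. The ambient metric space itself may be non-separable.\<close>

lemma dense_sequence:
  assumes "K \<noteq> {}"
  shows "\<exists>e :: nat \<Rightarrow> 'a. (\<forall>i. e i \<in> K) \<and> (\<forall>x\<in>K. \<forall>\<epsilon>>0. \<exists>i. dist x (e i) < \<epsilon>)"
proof -
  have "\<forall>n. \<exists>F. finite F \<and> F \<subseteq> K \<and> K \<subseteq> (\<Union>x\<in>F. ball x (1 / real (Suc n)))"
    using seq_compact_imp_totally_bounded compact_imp_seq_compact[OF compact_K] by fastforce
  then obtain F where F: "\<And>n. finite (F n)" "\<And>n. F n \<subseteq> K" "\<And>n. K \<subseteq> (\<Union>x\<in>F n. ball x (1 / real (Suc n)))"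
    by metis
  define D where "D = (\<Union>n. F n)"
  have D: "countable D" "D \<subseteq> K" using F(1,2) by (auto simp: D_def countable_finite)
  have "D \<noteq> {}" using assms F(3)[of 0] by (auto simp: D_def)
  then have r: "range (from_nat_into D) = D" by (rule range_from_nat_into[OF _ D(1)])
  show ?thesis
  proof (intro exI[of _ "from_nat_into D"] conjI allI ballI impI)
    show "from_nat_into D i \<in> K" for i using r D(2) by blast
    fix x \<epsilon> assume x: "x \<in> K" and \<epsilon>: "(0::real) < \<epsilon>"
    obtain n where n: "1 / real (Suc n) < \<epsilon>" using nat_approx_posE[OF \<epsilon>] by blast
    obtain y where y: "y \<in> F n" "dist y x < 1 / real (Suc n)" using F(3)[of n] x by auto
    have "y \<in> range (from_nat_into D)" unfolding r using y by (auto simp: D_def)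
    then obtain i where "from_nat_into D i = y" by auto
    then show "\<exists>i. dist x (from_nat_into D i) < \<epsilon>" using y n by (auto simp: dist_commute intro!: exI[of _ i])
  qed
qed

section \<open>The topological support of the measure\<close>

lemma ball_Int_measurable: "ball x r \<inter> K \<in> sets M"
  unfolding sets_M sets_restrict_space by (rule image_eqI[of _ _ "ball x r"]) auto

text \<open>On this set the value of a continuous representative is determined by its class, so
  point evaluation makes sense there.\<close>

definition supp :: "'a set" where
  "supp = {x \<in> K. \<forall>r>0. 0 < measure M (ball x r \<inter> K)}"

lemma supp_subset: "supp \<subseteq> K"
  by (auto simp: supp_def)

text \<open>The complement is covered by countably many null balls, with centres in a dense sequence
  and radii 1/(n + 1). A radius below half of that of a null ball about x ensures that such a ball
  containing x lies inside it.\<close>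

lemma AE_supp: "AE x in M. x \<in> supp"
proof (cases "K = {}")
  case True
  then show ?thesis using AE_in_K by (auto elim: eventually_mono)
next
  case False
  obtain e :: "nat \<Rightarrow> 'a" where e: "\<forall>x\<in>K. \<forall>\<epsilon>>0. \<exists>i. dist x (e i) < \<epsilon>"
    using dense_sequence[OF False] by blast
  have "AE x in M. \<forall>i n. measure M (ball (e i) (1 / real (Suc n)) \<inter> K) = 0 \<longrightarrow> x \<notin> ball (e i) (1 / real (Suc n)) \<inter> K"
    unfolding AE_all_countable
  proof (intro allI)
    fix i n
    let ?A = "ball (e i) (1 / real (Suc n)) \<inter> K"
    show "AE x in M. measure M ?A = 0 \<longrightarrow> x \<notin> ?A"
    proof (cases "measure M ?A = 0")
      case True
      then have "?A \<in> null_sets M" using ball_Int_measurable by (auto simp: null_sets_def emeasure_eq_measure)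
      then have "AE x in M. x \<notin> ?A" by (rule AE_not_in)
      then show ?thesis by eventually_elim simp
    qed simp
  qed
  then show ?thesis using AE_in_K
  proof eventually_elim
    case (elim x)
    show ?case
    proof (rule ccontr)
      assume "x \<notin> supp"
      then obtain r where r: "0 < r" "measure M (ball x r \<inter> K) = 0"
        using elim(2) measure_nonneg[of M] by (auto simp: supp_def less_le)
      obtain n where n: "1 / real (Suc n) < r / 2" using nat_approx_posE[of "r / 2"] r by auto
      obtain i where i: "dist x (e i) < 1 / real (Suc n)" using e[rule_format, OF elim(2), of "1 / real (Suc n)"] by auto
      have "ball (e i) (1 / real (Suc n)) \<subseteq> ball x r"
      proof
        fix y assume "y \<in> ball (e i) (1 / real (Suc n))"
        then have "dist x y < 1 / real (Suc n) + 1 / real (Suc n)"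
          using i dist_triangle[of x y "e i"] by (simp add: mem_ball)
        then show "y \<in> ball x r" using n by simp
      qed
      then have "measure M (ball (e i) (1 / real (Suc n)) \<inter> K) \<le> measure M (ball x r \<inter> K)"
        by (intro finite_measure_mono ball_Int_measurable) auto
      then have "measure M (ball (e i) (1 / real (Suc n)) \<inter> K) = 0"
        using r measure_nonneg[of M] by (metis antisym)
      then have "x \<notin> ball (e i) (1 / real (Suc n)) \<inter> K" using elim(1) by blast
      then show False using i elim(2) by (simp add: dist_commute)
    qed
  qed
qed

text \<open>If the bound failed at \<open>x\<close>, continuity would make it fail on a whole ball,
  and balls about points of the support are not null. This is the passage from almost everywhere
  statements to pointwise ones.\<close>

lemma continuous_le_on_supp:
  fixes g :: "'a \<Rightarrow> complex"
  assumes g: "continuous_on K g" and B: "AE x in M. cmod (g x) \<le> B" and x: "x \<in> supp"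
  shows "cmod (g x) \<le> B"
proof (rule ccontr)
  assume "\<not> cmod (g x) \<le> B"
  then have "0 < cmod (g x) - B" by simp
  moreover have xK: "x \<in> K" using x supp_subset by blast
  ultimately obtain d where d: "0 < d" "\<And>y. y \<in> K \<Longrightarrow> dist y x < d \<Longrightarrow> dist (g y) (g x) < cmod (g x) - B"
    using g unfolding continuous_on_iff by metis
  have "B < cmod (g y)" if "y \<in> ball x d \<inter> K" for y
  proof -
    have "dist (g y) (g x) < cmod (g x) - B" using that by (intro d) (auto simp: dist_commute)
    then show ?thesis using norm_triangle_ineq2[of "g x" "g y"] by (simp add: dist_norm norm_minus_commute)
  qed
  then have "AE y in M. y \<notin> ball x d \<inter> K" using B by (auto elim!: eventually_mono simp: not_le[symmetric])
  then have "emeasure M (ball x d \<inter> K) = 0"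
    using AE_iff_null_sets[OF ball_Int_measurable] by blast
  then show False using x d by (auto simp: supp_def emeasure_eq_measure)
qed

lemma continuous_eq_on_supp:
  fixes g h :: "'a \<Rightarrow> complex"
  assumes "continuous_on K g" "continuous_on K h" "AE x in M. g x = h x" "x \<in> supp"
  shows "g x = h x"
proof -
  have "cmod (g x - h x) \<le> 0"
    by (rule continuous_le_on_supp[OF _ _ assms(4)]) (use assms in \<open>auto intro!: continuous_intros elim: eventually_mono\<close>)
  then show ?thesis by simp
qed

lemma closedin_supp: "closedin (top_of_set K) supp"
  unfolding closedin_limpt
proof (intro conjI allI impI supp_subset)
  fix x assume x: "x islimpt supp \<and> x \<in> K"
  have "0 < measure M (ball x r \<inter> K)" if r: "0 < r" for r
  proof -
    obtain y where y: "y \<in> supp" "dist y x < r / 2"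
      using x[THEN conjunct1, unfolded islimpt_approachable, rule_format, of "r / 2"] r by auto
    have "ball y (r / 2) \<subseteq> ball x r"
    proof
      fix z assume "z \<in> ball y (r / 2)"
      then show "z \<in> ball x r" using y dist_triangle[of x z y] by (simp add: dist_commute)
    qed
    then have "measure M (ball y (r / 2) \<inter> K) \<le> measure M (ball x r \<inter> K)"
      by (intro finite_measure_mono ball_Int_measurable) auto
    moreover have "0 < measure M (ball y (r / 2) \<inter> K)" using y r by (simp add: supp_def)
    ultimately show ?thesis by linarith
  qed
  then show "x \<in> supp" using x by (simp add: supp_def)
qed

section \<open>Operators mapping into the continuous functions\<close>

text \<open>\<open>R\<close> chooses continuous representatives. At a point of the support,
  \<open>R u x\<close> is linear in \<open>u\<close> although \<open>R\<close> itself need not be,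
  and automatic boundedness with exponent 2 makes it a bounded functional, to which the Riesz
  representation applies. The conclusion covers every representative \<open>g\<close>, since later
  ones are chosen independently of \<open>R\<close>.\<close>

lemma point_evaluation:
  assumes T: "L2_bounded_operator M T" and cont: "\<And>u. u \<in> Lp_space 2 M \<Longrightarrow> T u \<in> continuous_classes K M"
  shows "\<exists>A k. 0 \<le> A \<and> (\<forall>x\<in>supp. k x \<in> Lp_space 2 M \<and> L2_norm M (k x) \<le> A \<and>
    (\<forall>u\<in>Lp_space 2 M. \<forall>g. continuous_on K g \<longrightarrow> (AE x in M. T u x = g x) \<longrightarrow> g x = L2_inner M u (k x)))"
proof -
  note T' = L2_bounded_operatorD[OF T]
  let ?L = "Lp_space 2 M"
  obtain A where A: "0 \<le> A" and bound: "\<And>u. u \<in> ?L \<Longrightarrow> AE x in M. cmod (T u x) \<le> A * (\<integral>x. cmod (u x) powr 2 \<partial>M) powr (1/2)"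
    using Lp_operator_bounded[OF T order_refl continuous_classes_bounded[OF cont]] by blast
  have root: "(\<integral>x. cmod (u x) powr 2 \<partial>M) powr (1/2) = L2_norm M u" for u
    by (simp add: L2_norm_def powr_half_sqrt)
  have est: "cmod (g x) \<le> A * L2_norm M u"
    if "x \<in> supp" "u \<in> ?L" "continuous_on K g" "AE x in M. T u x = g x" for x u g
  proof (rule continuous_le_on_supp[OF that(3) _ that(1)])
    show "AE x in M. cmod (g x) \<le> A * L2_norm M u"
      using bound[OF that(2)] that(4) unfolding root by eventually_elim simp
  qed
  have "\<forall>u. \<exists>g. u \<in> ?L \<longrightarrow> continuous_on K g \<and> (AE x in M. T u x = g x)"
    using cont by (auto simp: continuous_classes_def)
  then obtain R where R: "\<And>u. u \<in> ?L \<Longrightarrow> continuous_on K (R u)" "\<And>u. u \<in> ?L \<Longrightarrow> AE x in M. T u x = R u x"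
    by metis
  have "\<exists>k\<in>?L. L2_norm M k \<le> A \<and> (\<forall>u\<in>?L. R u x = L2_inner M u k)" if x: "x \<in> supp" for x
  proof -
    have add: "R (\<lambda>y. u y + v y) x = R u x + R v x" if "u \<in> ?L" "v \<in> ?L" for u v
    proof (rule continuous_eq_on_supp[OF _ _ _ x])
      have uv: "(\<lambda>y. u y + v y) \<in> ?L" using that by (intro Lp_add) auto
      show "continuous_on K (R (\<lambda>y. u y + v y))" "continuous_on K (\<lambda>x. R u x + R v x)"
        using that uv by (auto intro!: R continuous_intros)
      show "AE x in M. R (\<lambda>y. u y + v y) x = R u x + R v x"
        using R(2)[OF that(1)] R(2)[OF that(2)] R(2)[OF uv] T'(3)[OF that] by eventually_elim simp
    qed
    have scale: "R (\<lambda>y. c * u y) x = c * R u x" if "u \<in> ?L" for u c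
    proof (rule continuous_eq_on_supp[OF _ _ _ x])
      have cu: "(\<lambda>y. c * u y) \<in> ?L" using that by (intro Lp_scale)
      show "continuous_on K (R (\<lambda>y. c * u y))" "continuous_on K (\<lambda>x. c * R u x)"
        using that cu by (auto intro!: R continuous_intros)
      show "AE x in M. R (\<lambda>y. c * u y) x = c * R u x"
        using R(2)[OF that(1)] R(2)[OF cu] T'(4)[OF that, of c] by eventually_elim simp
    qed
    obtain k where k: "k \<in> ?L" "\<And>u. u \<in> ?L \<Longrightarrow> R u x = L2_inner M u k"
      using L2_Riesz[of "\<lambda>u. R u x" A, OF add scale est[OF x _ R]] by blast
    \<comment> \<open>Evaluating on \<open>k\<close> itself makes the norm bound independent of
      \<open>x\<close>.\<close>
    have "(L2_norm M k)\<^sup>2 = cmod (R k x)" using k by (simp add: L2_inner_self norm_power)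
    also have "\<dots> \<le> A * L2_norm M k" by (rule est[OF x k(1) R(1)[OF k(1)] R(2)[OF k(1)]])
    finally have "L2_norm M k \<le> A"
      using A L2_norm_nonneg[of M k] by (cases "L2_norm M k = 0") (auto simp: power2_eq_square less_le)
    then show ?thesis using k by blast
  qed
  then obtain k where k: "\<forall>x\<in>supp. k x \<in> ?L \<and> L2_norm M (k x) \<le> A \<and> (\<forall>u\<in>?L. R u x = L2_inner M u (k x))"
    by metis
  have "g x = L2_inner M u (k x)" if "x \<in> supp" "u \<in> ?L" "continuous_on K g" "AE x in M. T u x = g x" for x u g
  proof -
    have "AE x in M. g x = R u x" using that(4) R(2)[OF that(2)] by eventually_elim simp
    then have "g x = R u x" by (rule continuous_eq_on_supp[OF that(3) R(1)[OF that(2)] _ that(1)])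
    then show ?thesis using k that by simp
  qed
  then show ?thesis using A k by blast
qed

text \<open>The inner products that form the kernel make sense only for pairs of support points,
  while a continuous kernel must live on \<open>K \<times> K\<close>. Values off the support do not
  affect the integrals almost everywhere, so any continuous extension will do.\<close>

lemma Tietze_extension_supp:
  fixes f :: "'a \<times> 'a \<Rightarrow> complex"
  assumes f: "continuous_on (supp \<times> supp) f"
  obtains F where "continuous_on (K \<times> K) F" "\<And>z. z \<in> supp \<times> supp \<Longrightarrow> F z = f z"
proof -
  have cl: "closedin (top_of_set (K \<times> K)) (supp \<times> supp)"
    by (intro closedin_Times closedin_supp)
  have norm: "normal_space (top_of_set (K \<times> K))"
    by (intro metrizable_imp_normal_space metrizable_space_subtopology metrizable_space_euclidean)
  have sub: "subtopology (top_of_set (K \<times> K)) (supp \<times> supp) = top_of_set (supp \<times> supp)"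
    using supp_subset by (simp add: subtopology_subtopology Int_absorb1 Sigma_mono)
  have ext: "\<exists>F. continuous_on (K \<times> K) F \<and> (\<forall>z\<in>supp \<times> supp. F z = g z)"
    if "continuous_on (supp \<times> supp) g" for g :: "'a \<times> 'a \<Rightarrow> real"
    by (rule Tietze_extension_realinterval[OF norm cl is_interval_univ, of g])
      (use that in \<open>auto simp: sub\<close>)
  obtain F1 F2 where F: "continuous_on (K \<times> K) F1" "\<And>z. z \<in> supp \<times> supp \<Longrightarrow> F1 z = Re (f z)"
    "continuous_on (K \<times> K) F2" "\<And>z. z \<in> supp \<times> supp \<Longrightarrow> F2 z = Im (f z)"
    using ext[OF continuous_on_Re[OF f]] ext[OF continuous_on_Im[OF f]] by metis
  show thesis
  proof (rule that[of "\<lambda>z. Complex (F1 z) (F2 z)"])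
    show "continuous_on (K \<times> K) (\<lambda>z. Complex (F1 z) (F2 z))"
      unfolding Complex_eq by (intro continuous_intros F)
  qed (simp add: F)
qed

text \<open>If \<open>k\<^sub>x\<close> represents the evaluation at \<open>x\<close> of \<open>T\<close> then \<open>g\<^sub>x = T' k\<^sub>x\<close> represents that of \<open>T\<^sup>2\<close>.
  In contrast to \<open>k\<^sub>x\<close> it depends continuously on \<open>x\<close>, because \<open>g\<^sub>x(y) = \<langle>k\<^sub>x, k'\<^sub>y\<rangle>\<close> is
  separately continuous and bounded. Hence the kernel \<open>\<langle>g'\<^sub>y, g\<^sub>x\<rangle>\<close> of \<open>T\<^sup>4\<close> is jointly continuous.\<close>

lemma fourth_power_has_continuous_kernel:
  assumes TT: "L2_adjoint_pair M T T'"
    and cont: "\<And>u. u \<in> Lp_space 2 M \<Longrightarrow> T u \<in> continuous_classes K M"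
    and cont': "\<And>u. u \<in> Lp_space 2 M \<Longrightarrow> T' u \<in> continuous_classes K M"
  shows "has_continuous_kernel K M (\<lambda>u. T (T (T (T u))))"
proof -
  let ?L = "Lp_space 2 M"
  note tt = L2_adjoint_pairD[OF TT]
  note tt' = L2_adjoint_pairD[OF L2_adjoint_pair_sym[OF TT]]
  note T1 = L2_bounded_operatorD(1)[OF tt(1)] and T'1 = L2_bounded_operatorD(1)[OF tt(2)]
  obtain A k where A: "0 \<le> A" and k_all: "\<forall>x\<in>supp. k x \<in> ?L \<and> L2_norm M (k x) \<le> A \<and>
    (\<forall>u\<in>?L. \<forall>g. continuous_on K g \<longrightarrow> (AE x in M. T u x = g x) \<longrightarrow> g x = L2_inner M u (k x))"
    using point_evaluation[OF tt(1) cont] by auto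
  have k: "\<And>x. x \<in> supp \<Longrightarrow> k x \<in> ?L" "\<And>x. x \<in> supp \<Longrightarrow> L2_norm M (k x) \<le> A"
    and kT: "\<And>x u g. x \<in> supp \<Longrightarrow> u \<in> ?L \<Longrightarrow> continuous_on K g \<Longrightarrow> AE x in M. T u x = g x \<Longrightarrow> g x = L2_inner M u (k x)"
    using k_all by blast+
  obtain A' k' where A': "0 \<le> A'" and k'_all: "\<forall>x\<in>supp. k' x \<in> ?L \<and> L2_norm M (k' x) \<le> A' \<and>
    (\<forall>u\<in>?L. \<forall>g. continuous_on K g \<longrightarrow> (AE x in M. T' u x = g x) \<longrightarrow> g x = L2_inner M u (k' x))"
    using point_evaluation[OF tt(2) cont'] by auto
  have k': "\<And>x. x \<in> supp \<Longrightarrow> k' x \<in> ?L" "\<And>x. x \<in> supp \<Longrightarrow> L2_norm M (k' x) \<le> A'"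
    and kT': "\<And>x u g. x \<in> supp \<Longrightarrow> u \<in> ?L \<Longrightarrow> continuous_on K g \<Longrightarrow> AE x in M. T' u x = g x \<Longrightarrow> g x = L2_inner M u (k' x)"
    using k'_all by blast+
  have "\<forall>x. \<exists>g. x \<in> supp \<longrightarrow> continuous_on K g \<and> (AE y in M. T' (k x) y = g y)"
    using cont'[OF k(1)] by (auto simp: continuous_classes_def)
  then obtain g where g: "\<And>x. x \<in> supp \<Longrightarrow> continuous_on K (g x)" "\<And>x. x \<in> supp \<Longrightarrow> AE y in M. T' (k x) y = g x y"
    by metis
  have "\<forall>x. \<exists>g. x \<in> supp \<longrightarrow> continuous_on K g \<and> (AE y in M. T (k' x) y = g y)"
    using cont[OF k'(1)] by (auto simp: continuous_classes_def)
  then obtain g' where g': "\<And>x. x \<in> supp \<Longrightarrow> continuous_on K (g' x)" "\<And>x. x \<in> supp \<Longrightarrow> AE y in M. T (k' x) y = g' x y"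
    by metis
  have gL: "g x \<in> ?L" "g' x \<in> ?L" if "x \<in> supp" for x
    using that by (auto intro!: continuous_Lp g g')
  have gk: "g x y = L2_inner M (k x) (k' y)" if "x \<in> supp" "y \<in> supp" for x y
    using that by (intro kT' k g)
  have gk': "g' y x = L2_inner M (k' y) (k x)" if "x \<in> supp" "y \<in> supp" for x y
    using that by (intro kT k' g')
  \<comment> \<open>Index and argument are exchanged: continuity of \<open>g' y\<close> in its
    argument becomes continuity of \<open>g\<close> in its index.\<close>
  have sym: "g x y = cnj (g' y x)" if "x \<in> supp" "y \<in> supp" for x y
    using that by (simp add: gk gk' flip: L2_inner_cnj)
  have gb: "cmod (g x y) \<le> A * A'" if "x \<in> supp" "y \<in> supp" for x y
  proof -
    have "cmod (g x y) \<le> L2_norm M (k x) * L2_norm M (k' y)"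
      unfolding gk[OF that] by (intro L2_Cauchy_Schwarz k k' that)
    also have "\<dots> \<le> A * A'" using that A by (intro mult_mono k k') auto
    finally show ?thesis .
  qed
  have gb': "cmod (g' y x) \<le> A * A'" if "x \<in> supp" "y \<in> supp" for x y
    using gb[OF that] by (simp add: sym[OF that])
  have T2: "h x = L2_inner M u (g x)"
    if "x \<in> supp" "u \<in> ?L" "continuous_on K h" "AE x in M. T (T u) x = h x" for x u h
  proof -
    have "h x = L2_inner M (T u) (k x)" by (rule kT[OF that(1) T1[OF that(2)] that(3,4)])
    also have "\<dots> = L2_inner M u (T' (k x))" using that by (intro tt(3) k)
    also have "\<dots> = L2_inner M u (g x)"
      using that by (intro L2_inner_cong g T'1 k gL) auto
    finally show ?thesis .
  qed
  have T'2: "h x = L2_inner M u (g' x)"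
    if "x \<in> supp" "u \<in> ?L" "continuous_on K h" "AE x in M. T' (T' u) x = h x" for x u h
  proof -
    have "h x = L2_inner M (T' u) (k' x)" by (rule kT'[OF that(1) T'1[OF that(2)] that(3,4)])
    also have "\<dots> = L2_inner M u (T (k' x))" using that by (intro tt'(3) k')
    also have "\<dots> = L2_inner M u (g' x)"
      using that by (intro L2_inner_cong g' T1 k' gL) auto
    finally show ?thesis .
  qed
  \<comment> \<open>On the support, T^4 u (x) = <T^2 u, g_x> = <u, T'^2 g_x> and T'^2 g_x (y) =
    <g_x, g'_y>; the kernel is the conjugate of the last value.\<close>
  define \<kappa> where "\<kappa> = (\<lambda>(x, y). L2_inner M (g' y) (g x))"
  have "continuous_on (supp \<times> supp) \<kappa>"
  proof (rule continuous_on_sequentiallyI)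
    fix w :: "nat \<Rightarrow> 'a \<times> 'a" and a assume w: "\<forall>n. w n \<in> supp \<times> supp" and a: "a \<in> supp \<times> supp" and lim: "w \<longlonglongrightarrow> a"
    define x y where "x n = fst (w n)" and "y n = snd (w n)" for n
    have wxy: "w n = (x n, y n)" for n by (simp add: x_def y_def)
    have xy: "x n \<in> supp" "y n \<in> supp" for n using w by (auto simp: x_def y_def mem_Times_iff)
    obtain x0 y0 where a0: "a = (x0, y0)" by fastforce
    have xy0: "x0 \<in> supp" "y0 \<in> supp" using a a0 by auto
    have lx: "x \<longlonglongrightarrow> x0" and ly: "y \<longlonglongrightarrow> y0"
      using tendsto_fst[OF lim] tendsto_snd[OF lim] by (simp_all add: a0 x_def [abs_def] y_def [abs_def])
    have "(\<lambda>n. \<integral>z. g' (y n) z * cnj (g (x n) z) \<partial>M) \<longlonglongrightarrow> (\<integral>z. g' y0 z * cnj (g x0 z) \<partial>M)"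
    proof (rule integral_dominated_convergence)
      show "(\<lambda>z. g' y0 z * cnj (g x0 z)) \<in> borel_measurable M"
        "\<And>n. (\<lambda>z. g' (y n) z * cnj (g (x n) z)) \<in> borel_measurable M"
        using xy xy0 by (auto intro!: continuous_measurable continuous_intros g g')
      show "integrable M (\<lambda>z. (A * A') * (A * A'))" by simp
      show "AE z in M. norm (g' (y n) z * cnj (g (x n) z)) \<le> (A * A') * (A * A')" for n
        using AE_supp
      proof eventually_elim
        case (elim z)
        show ?case unfolding norm_mult complex_mod_cnj
          using A A' elim xy by (intro mult_mono gb gb') auto
      qed
      show "AE z in M. (\<lambda>n. g' (y n) z * cnj (g (x n) z)) \<longlonglongrightarrow> g' y0 z * cnj (g x0 z)"
        using AE_supp
      proof eventually_elim
        case (elim z)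
        \<comment> \<open>By \<open>sym\<close> the varying points become arguments of the fixed
          continuous functions \<open>g' z\<close> and \<open>g z\<close>, which requires
          \<open>z\<close> in the support.\<close>
        have 1: "(\<lambda>n. g' z (x n)) \<longlonglongrightarrow> g' z x0"
          by (rule continuous_on_tendsto_compose[OF g'(1)[OF elim] lx])
            (use xy xy0 supp_subset in \<open>auto intro!: always_eventually\<close>)
        have 2: "(\<lambda>n. g z (y n)) \<longlonglongrightarrow> g z y0"
          by (rule continuous_on_tendsto_compose[OF g(1)[OF elim] ly])
            (use xy xy0 supp_subset in \<open>auto intro!: always_eventually\<close>)
        have "(\<lambda>n. cnj (g z (y n)) * g' z (x n)) \<longlonglongrightarrow> cnj (g z y0) * g' z x0"
          by (intro tendsto_intros 1 2)
        then show ?case using elim xy xy0 by (simp add: sym)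
      qed
    qed
    then show "(\<lambda>n. \<kappa> (w n)) \<longlonglongrightarrow> \<kappa> a"
      by (simp add: \<kappa>_def wxy a0 L2_inner_def)
  qed
  then obtain F where F: "continuous_on (K \<times> K) F" "\<And>z. z \<in> supp \<times> supp \<Longrightarrow> F z = \<kappa> z"
    using Tietze_extension_supp by blast
  show ?thesis
    unfolding has_continuous_kernel_def
  proof (intro exI[of _ F] conjI F(1) ballI)
    fix u assume u: "u \<in> ?L"
    have T2u: "T (T u) \<in> ?L" by (intro T1 u)
    obtain h where h: "continuous_on K h" "AE x in M. T (T (T (T u))) x = h x"
      using cont[OF T1[OF T2u]] by (auto simp: continuous_classes_def)
    show "AE x in M. T (T (T (T u))) x = (\<integral>y. F (x, y) * u y \<partial>M)"
      using h(2) AE_supp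
    proof eventually_elim
      case (elim x)
      have x: "x \<in> supp" by (rule elim)
      obtain w where w: "continuous_on K w" "AE y in M. T' (T' (g x)) y = w y"
        using cont'[OF T'1[OF gL(1)[OF x]]] by (auto simp: continuous_classes_def)
      have "h x = L2_inner M (T (T u)) (g x)" by (rule T2[OF x T2u h])
      also have "\<dots> = L2_inner M u (T' (T' (g x)))" using x by (simp add: tt(3) T1 T'1 u gL)
      also have "\<dots> = L2_inner M u w"
        using x by (intro L2_inner_cong w(2) u T'1 gL continuous_Lp w(1)) auto
      also have "\<dots> = (\<integral>y. F (x, y) * u y \<partial>M)"
        unfolding L2_inner_def
      proof (rule integral_cong_AE)
        \<comment> \<open>\<open>F\<close> agrees with \<open>\<kappa>\<close> only on the support,
          and only there is \<open>w\<close> evaluated through \<open>g' y\<close>; full measure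
          suffices under the integral.\<close>
        have eq: "AE y in M. cnj (w y) = F (x, y)"
          using AE_supp
        proof eventually_elim
          case (elim y)
          have "w y = L2_inner M (g x) (g' y)" using T'2[OF elim gL(1)[OF x] w] .
          then show ?case using elim x F(2)[of "(x, y)"] by (simp add: \<kappa>_def flip: L2_inner_cnj)
        qed
        then show "AE y in M. u y * cnj (w y) = F (x, y) * u y" by eventually_elim simp
        have um: "u \<in> borel_measurable M" using u by (simp add: Lp_space_def)
        have "continuous_on K (\<lambda>y. cnj (w y))" by (intro continuous_intros w)
        then show "(\<lambda>y. u y * cnj (w y)) \<in> borel_measurable M"
          using um continuous_measurable by measurable
        have "continuous_on K (\<lambda>y. F (x, y))"
          by (rule continuous_on_compose2[OF F(1)]) (use x supp_subset in \<open>auto intro!: continuous_intros\<close>)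
        then show "(\<lambda>y. F (x, y) * u y) \<in> borel_measurable M"
          using um continuous_measurable by measurable
      qed
      finally show ?case using elim by simp
    qed
  qed
qed

end

section \<open>Operators with a continuous kernel\<close>

lemma (in finite_measure) L2_imp_integrable:
  assumes "u \<in> Lp_space 2 M"
  shows "integrable M u"
proof -
  have "integrable M (\<lambda>x. cmod (u x) powr 1)"
    by (rule Lp_integrable, rule Lp_mono[OF assms]) auto
  then have "integrable M (\<lambda>x. cmod (u x))" by simp
  then show ?thesis using Lp_measurable[OF assms] by (simp add: integrable_norm_iff)
qed

lemma L2_cnj: "u \<in> Lp_space 2 M \<Longrightarrow> (\<lambda>x. cnj (u x)) \<in> Lp_space 2 M"
  using borel_measurable_continuous_on[of cnj u M] by (auto simp: L2_iff intro!: continuous_intros)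

context compact_borel_measure
begin

lemma kernel_section_continuous:
  assumes "continuous_on (K \<times> K) k" "x \<in> K"
  shows "continuous_on K (\<lambda>y. k (x, y))"
  by (rule continuous_on_compose2[OF assms(1)]) (use assms(2) in \<open>auto intro!: continuous_intros\<close>)

lemma kernel_bounded:
  fixes k :: "'a \<times> 'a \<Rightarrow> complex"
  assumes "continuous_on (K \<times> K) k"
  shows "\<exists>B\<ge>0. \<forall>x\<in>K. \<forall>y\<in>K. cmod (k (x, y)) \<le> B"
proof -
  have "bounded (k ` (K \<times> K))"
    using compact_imp_bounded compact_continuous_image[OF assms] compact_Times compact_K by blast
  then obtain B where "\<forall>z\<in>K \<times> K. cmod (k z) \<le> B" by (auto simp: bounded_iff)
  then have "\<forall>x\<in>K. \<forall>y\<in>K. cmod (k (x, y)) \<le> \<bar>B\<bar>" by (auto intro: order_trans[OF _ abs_ge_self])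
  then show ?thesis by (intro exI[of _ "\<bar>B\<bar>"]) simp
qed

lemma continuous_on_kernel_integral:
  assumes k: "continuous_on (K \<times> K) k" and u: "u \<in> Lp_space 2 M"
  shows "continuous_on K (\<lambda>x. \<integral>y. k (x, y) * u y \<partial>M :: complex)"
proof (rule continuous_on_sequentiallyI)
  fix x :: "nat \<Rightarrow> 'a" and a assume x: "\<forall>n. x n \<in> K" and a: "a \<in> K" and lim: "x \<longlonglongrightarrow> a"
  obtain B where B: "\<forall>x\<in>K. \<forall>y\<in>K. cmod (k (x, y)) \<le> B" using kernel_bounded[OF k] by blast
  have um: "u \<in> borel_measurable M" using u by (simp add: Lp_space_def)
  have m: "(\<lambda>y. k (c, y) * u y) \<in> borel_measurable M" if "c \<in> K" for c
    using um continuous_measurable[OF kernel_section_continuous[OF k that]] by measurable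
  show "(\<lambda>n. \<integral>y. k (x n, y) * u y \<partial>M) \<longlonglongrightarrow> (\<integral>y. k (a, y) * u y \<partial>M)"
  proof (rule integral_dominated_convergence)
    show "integrable M (\<lambda>y. B * cmod (u y))" using L2_imp_integrable[OF u] by simp
    show "AE y in M. norm (k (x n, y) * u y) \<le> B * cmod (u y)" for n
      using AE_in_K
    proof eventually_elim
      case (elim y)
      show ?case unfolding norm_mult by (intro mult_right_mono) (use B x elim in auto)
    qed
    show "AE y in M. (\<lambda>n. k (x n, y) * u y) \<longlonglongrightarrow> k (a, y) * u y"
      using AE_in_K
    proof eventually_elim
      case (elim y)
      have "(\<lambda>n. k (x n, y)) \<longlonglongrightarrow> k (a, y)"
        by (rule continuous_on_tendsto_compose[OF k]) (use x a elim lim in \<open>auto intro!: tendsto_intros\<close>)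
      then show ?case by (intro tendsto_intros)
    qed
  qed (use x a m in auto)
qed

text \<open>The Borel sets of a non-separable product space need not belong to the product \<open>\<sigma>\<close>-algebra,
  hence the approximation by functions that depend on \<open>x\<close> only through an index in a dense sequence.\<close>

lemma kernel_measurable_pair:
  fixes k :: "'a \<times> 'a \<Rightarrow> complex"
  assumes k: "continuous_on (K \<times> K) k"
  shows "k \<in> borel_measurable (M \<Otimes>\<^sub>M M)"
proof (cases "K = {}")
  case True
  then have "space (M \<Otimes>\<^sub>M M) = {}" by (simp add: space_pair_measure space_M)
  then show ?thesis using space_empty[of "M \<Otimes>\<^sub>M M"] by simp
next
  case False
  obtain e :: "nat \<Rightarrow> 'a" where e: "\<forall>i. e i \<in> K" "\<forall>x\<in>K. \<forall>\<epsilon>>0. \<exists>i. dist x (e i) < \<epsilon>"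
    using dense_sequence[OF False] by blast
  \<comment> \<open>Taking the least index makes the choice of a nearby point measurable.\<close>
  define c where "c n x = (LEAST i. dist x (e i) < 1 / real (Suc n))" for n x
  have [measurable]: "(\<lambda>x. dist x (e i)) \<in> borel_measurable M" for i
    by (intro continuous_measurable continuous_intros)
  have [measurable]: "c n \<in> measurable M (count_space UNIV)" for n
    unfolding c_def [abs_def] by measurable
  show ?thesis
  proof (rule borel_measurable_LIMSEQ_metric)
    show "(\<lambda>z. k (e (c n (fst z)), snd z)) \<in> borel_measurable (M \<Otimes>\<^sub>M M)" for n
    proof (rule measurable_compose_countable[where f="\<lambda>i z. k (e i, snd z)"])
      fix i
      have [measurable]: "(\<lambda>y. k (e i, y)) \<in> borel_measurable M"
        using e by (intro continuous_measurable kernel_section_continuous[OF k]) auto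
      show "(\<lambda>z. k (e i, snd z)) \<in> borel_measurable (M \<Otimes>\<^sub>M M)" by measurable
    qed measurable
    fix z assume "z \<in> space (M \<Otimes>\<^sub>M M)"
    then obtain x y where z: "z = (x, y)" "x \<in> K" "y \<in> K" by (auto simp: space_pair_measure space_M)
    have d: "dist x (e (c n x)) < 1 / real (Suc n)" for n
      unfolding c_def by (rule LeastI_ex) (use e z in auto)
    have "(\<lambda>n. e (c n x)) \<longlonglongrightarrow> x"
    proof (rule tendsto_dist_iff[THEN iffD2], rule Lim_null_comparison)
      show "\<forall>\<^sub>F n in sequentially. norm (dist (e (c n x)) x) \<le> 1 / real (Suc n)"
        using d by (auto intro!: always_eventually less_imp_le simp: dist_commute)
      show "(\<lambda>n. 1 / real (Suc n)) \<longlonglongrightarrow> 0" by (rule LIMSEQ_Suc[OF lim_1_over_n])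
    qed
    then have "(\<lambda>n. (e (c n x), y)) \<longlonglongrightarrow> (x, y)" by (intro tendsto_intros)
    then show "(\<lambda>n. k (e (c n (fst z)), snd z)) \<longlonglongrightarrow> k z"
      unfolding z fst_conv snd_conv
      by (rule continuous_on_tendsto_compose[OF k]) (use e z in \<open>auto intro!: always_eventually\<close>)
  qed
qed

text \<open>The kernel is bounded and L_2 functions are integrable for a finite measure, so B |u|
  |w| dominates on the product. The formula is bilinear; a conjugate is put on the function before
  it is applied.\<close>

lemma kernel_Fubini:
  fixes k :: "'a \<times> 'a \<Rightarrow> complex"
  assumes k: "continuous_on (K \<times> K) k" and u: "u \<in> Lp_space 2 M" and w: "w \<in> Lp_space 2 M"
  shows "(\<integral>x. (\<integral>y. k (x, y) * w y \<partial>M) * u x \<partial>M) = (\<integral>y. w y * (\<integral>x. k (x, y) * u x \<partial>M) \<partial>M)"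
proof -
  interpret P: pair_sigma_finite M M ..
  note [measurable] = kernel_measurable_pair[OF k] Lp_measurable[OF u] Lp_measurable[OF w]
  obtain B where B: "0 \<le> B" "\<forall>x\<in>K. \<forall>y\<in>K. cmod (k (x, y)) \<le> B" using kernel_bounded[OF k] by blast
  have uw: "integrable (M \<Otimes>\<^sub>M M) (\<lambda>z. B * (cmod (u (fst z)) * cmod (w (snd z))))"
    by (intro integrable_mult_right P.Fubini_integrable)
      (use L2_imp_integrable[OF u] L2_imp_integrable[OF w] in auto)
  have int: "integrable (M \<Otimes>\<^sub>M M) (\<lambda>(x, y). k (x, y) * w y * u x)"
  proof (rule Bochner_Integration.integrable_bound[OF uw])
    show "AE z in M \<Otimes>\<^sub>M M. norm (case z of (x, y) \<Rightarrow> k (x, y) * w y * u x)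
        \<le> norm (B * (cmod (u (fst z)) * cmod (w (snd z))))"
    proof (intro AE_I2)
      fix z assume "z \<in> space (M \<Otimes>\<^sub>M M)"
      then have "cmod (k z) * (cmod (u (fst z)) * cmod (w (snd z))) \<le> B * (cmod (u (fst z)) * cmod (w (snd z)))"
        using B by (intro mult_right_mono) (auto simp: space_pair_measure space_M)
      then show "norm (case z of (x, y) \<Rightarrow> k (x, y) * w y * u x) \<le> norm (B * (cmod (u (fst z)) * cmod (w (snd z))))"
        using B(1) by (simp add: split_beta norm_mult mult_ac)
    qed
  qed measurable
  have "(\<integral>x. (\<integral>y. k (x, y) * w y \<partial>M) * u x \<partial>M) = (\<integral>x. (\<integral>y. k (x, y) * w y * u x \<partial>M) \<partial>M)"
    by simp
  also have "\<dots> = (\<integral>y. (\<integral>x. k (x, y) * w y * u x \<partial>M) \<partial>M)"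
    by (rule P.Fubini_integral[OF int, symmetric])
  also have "\<dots> = (\<integral>y. w y * (\<integral>x. k (x, y) * u x \<partial>M) \<partial>M)"
    by (simp add: mult.commute mult.left_commute flip: integral_mult_right_zero)
  finally show ?thesis .
qed

lemma has_continuous_kernel_imp_continuous:
  assumes "has_continuous_kernel K M T" "u \<in> Lp_space 2 M"
  shows "T u \<in> continuous_classes K M"
  using assms continuous_on_kernel_integral unfolding has_continuous_kernel_def continuous_classes_def
  by blast

text \<open>The adjoint has the conjugate transpose \<open>k'\<close> as kernel, which is continuous
  together with \<open>k\<close>. Hence (i), which concerns \<open>S t\<close> alone, also yields
  the condition on the adjoints in (iii).\<close>

lemma has_continuous_kernel_adjoint:
  assumes TT: "L2_adjoint_pair M T T'" and T: "has_continuous_kernel K M T"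
  shows "has_continuous_kernel K M T'"
proof -
  note tt = L2_adjoint_pairD[OF TT]
  note T1 = L2_bounded_operatorD(1)[OF tt(1)] and T'1 = L2_bounded_operatorD(1)[OF tt(2)]
  obtain k where k: "continuous_on (K \<times> K) k"
    and kT: "\<And>u. u \<in> Lp_space 2 M \<Longrightarrow> AE x in M. T u x = (\<integral>y. k (x, y) * u y \<partial>M)"
    using T unfolding has_continuous_kernel_def by blast
  define k' where "k' z = cnj (k (snd z, fst z))" for z
  have k': "continuous_on (K \<times> K) k'"
    unfolding k'_def by (intro continuous_intros continuous_on_compose2[OF k]) auto
  show ?thesis
    unfolding has_continuous_kernel_def
  proof (intro exI[of _ k'] conjI k' ballI L2_eqI)
    fix u assume u: "u \<in> Lp_space 2 M"
    show "T' u \<in> Lp_space 2 M" by (rule T'1[OF u])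
    show v: "(\<lambda>x. \<integral>y. k' (x, y) * u y \<partial>M) \<in> Lp_space 2 M"
      by (intro continuous_Lp continuous_on_kernel_integral k' u) simp
    fix w assume w: "w \<in> Lp_space 2 M"
    have "L2_inner M w (T' u) = L2_inner M (T w) u" by (rule tt(3)[OF w u, symmetric])
    also have "\<dots> = L2_inner M (\<lambda>x. \<integral>y. k (x, y) * w y \<partial>M) u"
      by (intro L2_inner_cong kT w T1 u continuous_Lp continuous_on_kernel_integral k) auto
    also have "\<dots> = (\<integral>y. w y * (\<integral>x. k (x, y) * cnj (u x) \<partial>M) \<partial>M)"
      unfolding L2_inner_def by (rule kernel_Fubini[OF k L2_cnj[OF u] w])
    also have "\<dots> = L2_inner M w (\<lambda>x. \<integral>y. k' (x, y) * u y \<partial>M)"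
      unfolding L2_inner_def Bochner_Integration.integral_cnj[symmetric] by (simp add: k'_def)
    finally show "L2_inner M w (T' u) = L2_inner M w (\<lambda>x. \<integral>y. k' (x, y) * u y \<partial>M)" .
  qed
qed

end

section \<open>Semigroups\<close>

lemma L2_semigroupD:
  assumes "L2_semigroup M S"
  shows "\<And>t. 0 < t \<Longrightarrow> L2_bounded_operator M (S t)"
    "\<And>t s u. 0 < t \<Longrightarrow> 0 < s \<Longrightarrow> u \<in> Lp_space 2 M \<Longrightarrow> AE x in M. S (t + s) u x = S t (S s u) x"
  using assms by (auto simp: L2_semigroup_def)

text \<open>Taking adjoints reverses products, and commutativity of the addition of times undoes
  this. The semigroup law for \<open>S'\<close> permits the exponent iteration to be run on the
  adjoints too.\<close>

lemma (in finite_measure) L2_semigroup_adjoint: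
  assumes S: "L2_semigroup M S" and SS: "\<And>t. 0 < t \<Longrightarrow> L2_adjoint_pair M (S t) (S' t)"
  shows "L2_semigroup M S'"
  unfolding L2_semigroup_def
proof (intro conjI allI impI ballI)
  show "L2_bounded_operator M (S' t)" if "0 < t" for t by (rule L2_adjoint_pairD(2)[OF SS[OF that]])
  note S'1 = L2_bounded_operatorD(1)[OF this] and S1 = L2_bounded_operatorD(1)[OF L2_semigroupD(1)[OF S]]
  fix t s :: real and u assume ts: "0 < t" "0 < s" and u: "u \<in> Lp_space 2 M"
  then have st: "0 < s + t" by simp
  have "AE x in M. S' (s + t) u x = S' t (S' s u) x"
  proof (rule L2_eqI)
    fix w assume w: "w \<in> Lp_space 2 M"
    have "L2_inner M w (S' (s + t) u) = L2_inner M (S (s + t) w) u"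
      using L2_adjoint_pairD(3)[OF SS[OF st] w u] by simp
    also have "\<dots> = L2_inner M (S s (S t w)) u"
      using L2_semigroupD(2)[OF S ts(2,1) w] u w ts st
      by (intro L2_inner_cong S1) auto
    also have "\<dots> = L2_inner M (S t w) (S' s u)"
      using ts w u by (intro L2_adjoint_pairD(3) SS S1)
    also have "\<dots> = L2_inner M w (S' t (S' s u))"
      using ts w u by (intro L2_adjoint_pairD(3) SS S'1)
    finally show "L2_inner M w (S' (s + t) u) = L2_inner M w (S' t (S' s u))" .
  qed (use ts st u in \<open>auto intro!: S'1\<close>)
  then show "AE x in M. S' (t + s) u x = S' t (S' s u) x" by (simp add: add.commute)
qed

lemma continuous_classes_cong:
  assumes "g \<in> continuous_classes K M" "AE x in M. f x = g x"
  shows "f \<in> continuous_classes K M"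
proof -
  obtain h where "continuous_on K h" "AE x in M. g x = h x"
    using assms(1) by (auto simp: continuous_classes_def)
  moreover from this(2) assms(2) have "AE x in M. f x = h x" by eventually_elim simp
  ultimately show ?thesis by (auto simp: continuous_classes_def)
qed

context compact_borel_measure
begin

text \<open>One half of the time is spent on reaching L_r, the other half on passing from L_r to
  continuous functions.\<close>

lemma semigroup_continuous_of_Lp:
  assumes S: "L2_semigroup M S" and SS: "\<And>t. 0 < t \<Longrightarrow> L2_adjoint_pair M (S t) (S' t)" and r: "2 \<le> r"
    and c: "\<And>t u. 0 < t \<Longrightarrow> u \<in> Lp_space r M \<Longrightarrow> S t u \<in> continuous_classes K M"
    and c': "\<And>t u. 0 < t \<Longrightarrow> u \<in> Lp_space r M \<Longrightarrow> S' t u \<in> continuous_classes K M"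
    and t: "0 < t" and u: "u \<in> Lp_space 2 M"
  shows "S t u \<in> continuous_classes K M"
proof -
  have "S (t/2) u \<in> Lp_space r M"
    by (rule semigroup_Lp_smoothing[OF S SS r continuous_classes_bounded[OF c] continuous_classes_bounded[OF c']])
      (use t u in auto)
  then have "S (t/2) (S (t/2) u) \<in> continuous_classes K M" using t by (intro c) auto
  moreover have "AE x in M. S t u x = S (t/2) (S (t/2) u) x"
    using L2_semigroupD(2)[OF S _ _ u, of "t/2" "t/2"] t by simp
  ultimately show ?thesis by (rule continuous_classes_cong)
qed

text \<open>\<open>S t\<close> is the fourth power of \<open>S (t/4)\<close>. The semigroup law
  holds only almost everywhere, so it is used inside nested applications through the fact that
  bounded operators respect this equality.\<close>

lemma semigroup_has_continuous_kernel:
  assumes S: "L2_semigroup M S" and SS: "\<And>t. 0 < t \<Longrightarrow> L2_adjoint_pair M (S t) (S' t)"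
    and c: "\<And>t u. 0 < t \<Longrightarrow> u \<in> Lp_space 2 M \<Longrightarrow> S t u \<in> continuous_classes K M"
    and c': "\<And>t u. 0 < t \<Longrightarrow> u \<in> Lp_space 2 M \<Longrightarrow> S' t u \<in> continuous_classes K M"
    and t: "0 < t"
  shows "has_continuous_kernel K M (S t)"
proof -
  define T where "T = S (t/4)"
  have t4: "0 < t/4" using t by simp
  note T = L2_bounded_operatorD[OF L2_semigroupD(1)[OF S t4], folded T_def]
  have "has_continuous_kernel K M (\<lambda>u. T (T (T (T u))))"
    unfolding T_def by (rule fourth_power_has_continuous_kernel[OF SS[OF t4] c[OF t4] c'[OF t4]])
  then obtain k where k: "continuous_on (K \<times> K) k"
      "\<And>u. u \<in> Lp_space 2 M \<Longrightarrow> AE x in M. T (T (T (T u))) x = (\<integral>y. k (x, y) * u y \<partial>M)"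
    unfolding has_continuous_kernel_def by blast
  have "AE x in M. S t u x = (\<integral>y. k (x, y) * u y \<partial>M)" if u: "u \<in> Lp_space 2 M" for u
  proof -
    have half: "AE x in M. S (t/2) v x = T (T v) x" if "v \<in> Lp_space 2 M" for v
      using L2_semigroupD(2)[OF S t4 t4 that] by (simp add: T_def)
    have S2: "S (t/2) u \<in> Lp_space 2 M"
      using L2_bounded_operatorD(1)[OF L2_semigroupD(1)[OF S] u] t by simp
    have TTu: "T (T u) \<in> Lp_space 2 M" by (intro T(1) u)
    have "AE x in M. T (S (t/2) u) x = T (T (T u)) x"
      by (rule T(2)[OF S2 TTu half[OF u]])
    then have "AE x in M. T (T (S (t/2) u)) x = T (T (T (T u))) x"
      by (rule T(2)[OF T(1)[OF S2] T(1)[OF TTu]])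
    moreover have "AE x in M. S t u x = S (t/2) (S (t/2) u) x"
      using L2_semigroupD(2)[OF S _ _ u, of "t/2" "t/2"] t by simp
    ultimately show ?thesis using half[OF S2] k(2)[OF u] by eventually_elim simp
  qed
  then show ?thesis using k(1) unfolding has_continuous_kernel_def by blast
qed

end

theorem theorem2p1:
  fixes K :: "'a::metric_space set"
    and \<mu> :: "'a measure"
    and S :: "real \<Rightarrow> ('a \<Rightarrow> complex) \<Rightarrow> 'a \<Rightarrow> complex"
  assumes "compact K"
    and "sets \<mu> = sets (restrict_space borel K)"
    and "finite_measure \<mu>"
    and "L2_semigroup \<mu> S"
  shows
    "((\<forall>t>0. has_continuous_kernel K \<mu> (S t))
      \<longleftrightarrow>
      (\<exists>p\<^sub>0\<ge>2. \<forall>t>0. S t ` Lp_space p\<^sub>0 \<mu> \<subseteq> continuous_classes K \<mu> \<and>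
                    L2_adjoint \<mu> (S t) ` Lp_space p\<^sub>0 \<mu> \<subseteq> continuous_classes K \<mu>))
     \<and>
     ((\<exists>p\<^sub>0\<ge>2. \<forall>t>0. S t ` Lp_space p\<^sub>0 \<mu> \<subseteq> continuous_classes K \<mu> \<and>
                    L2_adjoint \<mu> (S t) ` Lp_space p\<^sub>0 \<mu> \<subseteq> continuous_classes K \<mu>)
      \<longleftrightarrow>
      (\<forall>t>0. S t ` Lp_space 2 \<mu> \<subseteq> continuous_classes K \<mu> \<and>
             L2_adjoint \<mu> (S t) ` Lp_space 2 \<mu> \<subseteq> continuous_classes K \<mu>))"
proof -
  interpret finite_measure \<mu> by (rule assms(3))
  interpret compact_borel_measure \<mu> K by unfold_locales (rule assms)+
  define S' where "S' t = L2_adjoint \<mu> (S t)" for t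
  have SS: "L2_adjoint_pair \<mu> (S t) (S' t)" if "0 < t" for t
    unfolding S'_def by (rule L2_adjoint_pair_adjoint[OF L2_semigroupD(1)[OF assms(4) that]])
  have SS': "L2_adjoint_pair \<mu> (S' t) (S t)" if "0 < t" for t
    by (rule L2_adjoint_pair_sym[OF SS[OF that]])
  have S': "L2_semigroup \<mu> S'" by (rule L2_semigroup_adjoint[OF assms(4) SS])
  define C where "C p \<longleftrightarrow> (\<forall>t>0. S t ` Lp_space p \<mu> \<subseteq> continuous_classes K \<mu> \<and>
      S' t ` Lp_space p \<mu> \<subseteq> continuous_classes K \<mu>)" for p
  have CD: "S t u \<in> continuous_classes K \<mu>" "S' t u \<in> continuous_classes K \<mu>"
    if "C p" "0 < t" "u \<in> Lp_space p \<mu>" for p t u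
    using that unfolding C_def by blast+
  have i_iii: "C 2" if "\<forall>t>0. has_continuous_kernel K \<mu> (S t)"
    using that has_continuous_kernel_imp_continuous has_continuous_kernel_adjoint[OF SS]
    unfolding C_def by blast
  have ii_iii: "C 2" if "2 \<le> r" "C r" for r
    unfolding C_def
    \<comment> \<open>The lemma concerns the first member of an adjoint pair; its second instance,
      with the pair reversed, gives the adjoints.\<close>
    using semigroup_continuous_of_Lp[OF assms(4) SS that(1) CD[OF that(2)]]
      semigroup_continuous_of_Lp[OF S' SS' that(1) CD(2,1)[OF that(2)]] by blast
  have iii_i: "\<forall>t>0. has_continuous_kernel K \<mu> (S t)" if "C 2"
    using semigroup_has_continuous_kernel[OF assms(4) SS CD[OF that]] by blast
  \<comment> \<open>Condition (iii) is (ii) at exponent 2, and all other implications pass through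
    (iii).\<close>
  have "((\<forall>t>0. has_continuous_kernel K \<mu> (S t)) \<longleftrightarrow> (\<exists>p\<^sub>0\<ge>2. C p\<^sub>0)) \<and> ((\<exists>p\<^sub>0\<ge>2. C p\<^sub>0) \<longleftrightarrow> C 2)"
    using i_iii ii_iii iii_i by blast
  then show ?thesis unfolding C_def S'_def .
qed

end
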